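(* Let $(\xi_i)_{i\ge1}$ be i.i.d. real random variables with common law $\nu$ such that: (C1) there is $B>0$ with $\mathbb E[e^{t\xi}]<\infty$ for every $t\in[0,B]$; (C2) $\mathbb E[\xi]<0$; (C3) $\nu$ is non-lattice. Let $\theta$ be the unique positive number such that $\mathbb E[e^{\theta\xi}]=1$. Let $S_n=\sum_{i=1}^n\xi_i$ and $T_N=\sum_{1\le k\le m\le N}e^{S_m-S_k}$. (1) If $\theta<1$, then $$\mathbb P[T_N\ge u]\le CN\frac{(\ln u)^\theta}{u^\theta}.$$ As a consequence the random variable $\frac{T_N}{N^{1/\theta}\ln N}$ is bounded in probability: $$\mathbb P\Big[\frac{T_N}{N^{1/\theta}\ln N}\ge v\Big]\le\frac{C}{v^\theta}.$$ (2) If $\theta>1$, then there exists $C_0>0$ such that, for $u>C_0N\ln N$, $$\mathbb P[T_N\ge u]\le\frac{CN(\ln u)^\theta}{u^\theta}.$$ As a consequence the random variable $\frac{T_N}{N\ln N}$ converges to zero in probability: $$\mathbb P\Big[\frac{T_N}{N\ln N}\ge v\Big]\le\frac{C}{N^{\theta-1}v^\theta}.$$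
   Context: Here $\xi$ denotes a random variable with law $\nu$. A law on $\mathbb R$ is non-lattice if it is not supported on a set of the form $a+b\mathbb Z$. $C$ denotes a constant, possibly different in each display.
   Formalization: In (1) the first bound is for u≥u₀, any u₀>1, C depending on u₀ (it fails as u→1+); in (2) the first bound also needs u>1 (N=1), the last is for v≥v₀, any v₀>0, C depending on v₀ (it fails at v=1/ln N, as T_N≥N); N≥2 where ln N divides. *)

theory Defs
  imports "HOL-Probability.Probability"
begin

(* The case b = 0 covers point masses. *)
definition non_lattice :: "real measure \<Rightarrow> bool" where
  "non_lattice \<nu> \<longleftrightarrow> \<not> (\<exists>a b. AE x in \<nu>. x \<in> {a + b * real_of_int k | k. True})"

definition partial_sum :: "(nat \<Rightarrow> 'a \<Rightarrow> real) \<Rightarrow> nat \<Rightarrow> 'a \<Rightarrow> real" where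
  "partial_sum \<xi> n \<omega> = (\<Sum>i=1..n. \<xi> i \<omega>)"

definition exp_pair_sum :: "(nat \<Rightarrow> 'a \<Rightarrow> real) \<Rightarrow> nat \<Rightarrow> 'a \<Rightarrow> real" where
  "exp_pair_sum \<xi> N \<omega> =
     (\<Sum>(k, m) \<in> {(k, m). 1 \<le> k \<and> k \<le> m \<and> m \<le> N}.
        exp (partial_sum \<xi> m \<omega> - partial_sum \<xi> k \<omega>))"

definition tendsto_in_prob :: "'a measure \<Rightarrow> (nat \<Rightarrow> 'a \<Rightarrow> real) \<Rightarrow> real \<Rightarrow> bool" where
  "tendsto_in_prob M X c \<longleftrightarrow>
     (\<forall>\<epsilon>>0. (\<lambda>n. measure M {\<omega> \<in> space M. \<bar>X n \<omega> - c\<bar> \<ge> \<epsilon>}) \<longlonglongrightarrow> 0)"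

(* A family of real random variables is bounded in probability iff its laws are tight. *)
definition bounded_in_prob :: "'a measure \<Rightarrow> (nat \<Rightarrow> 'a \<Rightarrow> real) \<Rightarrow> bool" where
  "bounded_in_prob M X \<longleftrightarrow> tight (\<lambda>n. distr M borel (X n))"

end

theory Submission
  imports Defs
begin

text \<open>Write \<open>W\<^sub>m\<close> for the sum of \<open>exp (S\<^sub>m - S\<^sub>k)\<close> over \<open>1 \<le> k \<le> m\<close>, so that \<open>T\<^sub>N = W\<^sub>1 + \<dots> + W\<^sub>N\<close>. The whole theorem
rests on the fact that \<open>W\<^sub>m\<close>, uniformly in \<open>m\<close>, has a tail of order \<open>u powr (- \<theta>)\<close>
(\<open>perpetuity_tail\<close>, \<open>chain_and_perpetuity_tail\<close>). By time reversal \<open>W\<^sub>m\<close> is distributed as a perpetuity, a sum of exponentials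
of the walk. Lundberg's inequality gives the order \<open>u powr (- \<theta>)\<close> for the maximal term, and since the
walk has negative drift it spends an exponentially tight amount of time near every level that it visits
(\<open>visits_apart_prob\<close>), so that the sum is not of larger order than the maximum.

For \<open>\<theta> < 1\<close> a sum of \<open>N\<close> such variables is dominated by its largest term, whatever their dependence:
truncation at level \<open>u\<close> and Markov's inequality bound the tail of \<open>T\<^sub>N\<close> by a multiple of
\<open>N * u powr (- \<theta>)\<close>, without logarithm (\<open>chain_sum_tail_heavy\<close>). All claims for \<open>\<theta> < 1\<close> follow by specialising \<open>u\<close>.

For \<open>\<theta> > 1\<close> the mean of \<open>T\<^sub>N\<close> is of order \<open>N\<close>, and the claims reduce to the bound \<open>C N (ln N / u) powr \<theta>\<close> for
\<open>u\<close> at least a given multiple of \<open>N ln N\<close> (\<open>chain_sum_tail_light\<close>). The logarithm has to be that of \<open>N\<close>, not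
of \<open>u\<close>, because the normalised statement is uniform as \<open>u\<close> tends to infinity with \<open>N\<close> fixed. Two
regimes are distinguished. For \<open>u \<le> N\<^sup>3\<close>, the recursion \<open>W\<^sub>m = 1 + exp \<xi>\<^sub>m * W\<^bsub>m-1\<^esub>\<close> is contracting in mean and,
truncated at a level of order \<open>u / ln N\<close>, admits an exponential supermartingale
(\<open>truncated_exponential_moment\<close>); exceeding the truncation level accounts for the factor \<open>(ln N) powr \<theta>\<close>.
For \<open>u \<ge> N\<^sup>3\<close>, the sum is stopped when it first passes \<open>u / 3\<close>, and reaching \<open>u\<close> then requires a single large
value, a second passage, or a large product of an independent past and future
(\<open>chain_sum_tail_far\<close>).\<close>

section \<open>The random walk, its perpetuities and its affine recursion\<close>

definition walk :: "(nat \<Rightarrow> real) \<Rightarrow> nat \<Rightarrow> nat \<Rightarrow> real" where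
  "walk x k m = (\<Sum>i\<in>{k<..m}. x i)"
text \<open>For \<open>m \<ge> k\<close> the walk increment is \<open>S\<^sub>m - S\<^sub>k\<close>. The double sum \<open>T\<^sub>N\<close> is read in two
ways: grouped by its smaller index it consists of truncated perpetuities, grouped by its larger index
of the successive values of the affine recursion \<open>W\<^sub>m = 1 + exp \<xi>\<^sub>m * W\<^bsub>m-1\<^esub>\<close>, started at \<open>W\<^sub>0 = 0\<close>.\<close>
definition perpetuity :: "(nat \<Rightarrow> real) \<Rightarrow> nat \<Rightarrow> nat \<Rightarrow> real" where
  "perpetuity x k n = (\<Sum>m\<in>{k..n}. exp (walk x k m))"
definition affine_chain :: "(nat \<Rightarrow> real) \<Rightarrow> nat \<Rightarrow> real" where
  "affine_chain x m = (\<Sum>k\<in>{1..m}. exp (walk x k m))"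
definition chain_sum :: "(nat \<Rightarrow> real) \<Rightarrow> nat \<Rightarrow> real" where
  "chain_sum x m = (\<Sum>j\<in>{1..m}. affine_chain x j)"
text \<open>Every functional of the steps is viewed as a function on the full sequence space, so that it is
measurable regardless of the coordinates on which it depends.\<close>
abbreviation seqM :: "(nat \<Rightarrow> real) measure" where
  "seqM \<equiv> PiM UNIV (\<lambda>_. borel)"
definition first_in :: "real set \<Rightarrow> nat \<Rightarrow> (nat \<Rightarrow> real) \<Rightarrow> bool" where
  "first_in I t x \<longleftrightarrow> walk x 0 t \<in> I \<and> (\<forall>s<t. walk x 0 s \<notin> I)"

lemma walk_measurable [measurable]: "(\<lambda>x. walk x k m) \<in> borel_measurable seqM"
  unfolding walk_def by measurable
lemma perpetuity_measurable [measurable]: "(\<lambda>x. perpetuity x k m) \<in> borel_measurable seqM"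
  unfolding perpetuity_def by measurable
lemma chain_measurable [measurable]: "(\<lambda>x. affine_chain x m) \<in> borel_measurable seqM"
  unfolding affine_chain_def by measurable
lemma chain_sum_measurable [measurable]: "(\<lambda>x. chain_sum x m) \<in> borel_measurable seqM"
  unfolding chain_sum_def by measurable
lemma first_in_measurable [measurable]:
  assumes [measurable]: "I \<in> sets borel"
  shows "Measurable.pred seqM (first_in I t)"
  unfolding first_in_def by measurable

lemma walk_self [simp]: "walk x k k = 0" by (simp add: walk_def)
lemma walk_append: "k \<le> l \<Longrightarrow> l \<le> m \<Longrightarrow> walk x k l + walk x l m = walk x k m"
  unfolding walk_def by (subst sum.union_disjoint[symmetric]) (auto intro!: sum.cong)
lemma walk_cong: "(\<And>i. k < i \<Longrightarrow> i \<le> m \<Longrightarrow> x i = y i) \<Longrightarrow> walk x k m = walk y k m"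
  unfolding walk_def by (intro sum.cong) auto
lemma chain_cong: "(\<And>i. 0 < i \<Longrightarrow> i \<le> m \<Longrightarrow> x i = y i) \<Longrightarrow> affine_chain x m = affine_chain y m"
  unfolding affine_chain_def by (intro sum.cong arg_cong[where f=exp] walk_cong) auto
lemma chain_sum_cong: "(\<And>i. 0 < i \<Longrightarrow> i \<le> m \<Longrightarrow> x i = y i) \<Longrightarrow> chain_sum x m = chain_sum y m"
  unfolding chain_sum_def by (intro sum.cong chain_cong) auto
lemma perpetuity_cong: "(\<And>i. k < i \<Longrightarrow> i \<le> m \<Longrightarrow> x i = y i) \<Longrightarrow> perpetuity x k m = perpetuity y k m"
  unfolding perpetuity_def by (intro sum.cong arg_cong[where f=exp] walk_cong) auto
lemma chain_Suc: "affine_chain x (Suc m) = 1 + exp (x (Suc m)) * affine_chain x m"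
proof -
  have "walk x k (Suc m) = x (Suc m) + walk x k m" if "k \<le> m" for k
    using walk_append[of k m "Suc m" x] that by (simp add: walk_def atLeastSucAtMost_greaterThanAtMost[symmetric])
  then have "(\<Sum>k\<in>{1..m}. exp (walk x k (Suc m))) = exp (x (Suc m)) * affine_chain x m"
    unfolding affine_chain_def sum_distrib_left by (intro sum.cong) (auto simp: exp_add)
  then show ?thesis by (simp add: affine_chain_def)
qed
lemma chain_0 [simp]: "affine_chain x 0 = 0" by (simp add: affine_chain_def)
lemma chain_sum_0 [simp]: "chain_sum x 0 = 0" by (simp add: chain_sum_def)
lemma chain_sum_Suc: "chain_sum x (Suc m) = chain_sum x m + affine_chain x (Suc m)"
  by (simp add: chain_sum_def)
lemma chain_nonneg: "0 \<le> affine_chain x m" by (auto simp: affine_chain_def intro: sum_nonneg)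
lemma chain_sum_mono: "m \<le> n \<Longrightarrow> chain_sum x m \<le> chain_sum x n"
  unfolding chain_sum_def by (intro sum_mono2) (auto simp: chain_nonneg)

section \<open>Independence of functionals of disjoint blocks of steps\<close>

context prob_space begin

text \<open>Dependence on a block is expressed pointwise, by invariance under changes outside the block.
Extending a partial sequence by zero transports such a functional to the product over the block, where
independence of restrictions applies.\<close>
lemma indep_var_blocks:
  assumes "indep_vars (\<lambda>_. borel) \<eta> I" "A \<subseteq> I" "B \<subseteq> I" "A \<inter> B = {}"
    and [measurable]: "F \<in> measurable seqM N1" "G \<in> measurable seqM N2"
    and F: "\<And>x y. (\<And>i. i \<in> A \<Longrightarrow> x i = y i) \<Longrightarrow> F x = F y"
    and G: "\<And>x y. (\<And>i. i \<in> B \<Longrightarrow> x i = y i) \<Longrightarrow> G x = G y"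
  shows "indep_var N1 (\<lambda>\<omega>. F (\<lambda>i. \<eta> i \<omega>)) N2 (\<lambda>\<omega>. G (\<lambda>i. \<eta> i \<omega>))"
proof -
  define e where "e J x = (\<lambda>i. if i \<in> J then x i else 0)" for J and x :: "nat \<Rightarrow> real"
  have e [measurable]: "e J \<in> measurable (PiM J (\<lambda>_. borel)) seqM" for J
  proof (rule measurable_PiM_single')
    fix i show "(\<lambda>x. e J x i) \<in> borel_measurable (PiM J (\<lambda>_. borel))"
      by (cases "i \<in> J") (auto simp: e_def)
  qed auto
  have "indep_var N1 ((F \<circ> e A) \<circ> (\<lambda>\<omega>. restrict (\<lambda>i. \<eta> i \<omega>) A)) N2 ((G \<circ> e B) \<circ> (\<lambda>\<omega>. restrict (\<lambda>i. \<eta> i \<omega>) B))"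
    by (rule indep_var_compose[OF indep_var_restrict[OF assms(1) assms(4,2,3)]]) measurable
  also have "(F \<circ> e A) \<circ> (\<lambda>\<omega>. restrict (\<lambda>i. \<eta> i \<omega>) A) = (\<lambda>\<omega>. F (\<lambda>i. \<eta> i \<omega>))"
    by (auto simp: fun_eq_iff e_def intro!: F)
  also have "(G \<circ> e B) \<circ> (\<lambda>\<omega>. restrict (\<lambda>i. \<eta> i \<omega>) B) = (\<lambda>\<omega>. G (\<lambda>i. \<eta> i \<omega>))"
    by (auto simp: fun_eq_iff e_def intro!: G)
  finally show ?thesis .
qed

lemma prob_blocks:
  assumes "indep_vars (\<lambda>_. borel) \<eta> I" "A \<subseteq> I" "B \<subseteq> I" "A \<inter> B = {}"
    and "Measurable.pred seqM P" "Measurable.pred seqM Q"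
    and "\<And>x y. (\<And>i. i \<in> A \<Longrightarrow> x i = y i) \<Longrightarrow> P x = P y"
    and "\<And>x y. (\<And>i. i \<in> B \<Longrightarrow> x i = y i) \<Longrightarrow> Q x = Q y"
  shows "\<P>(\<omega> in M. P (\<lambda>i. \<eta> i \<omega>) \<and> Q (\<lambda>i. \<eta> i \<omega>)) = \<P>(\<omega> in M. P (\<lambda>i. \<eta> i \<omega>)) * \<P>(\<omega> in M. Q (\<lambda>i. \<eta> i \<omega>))"
proof -
  have "indep_var (count_space UNIV) (\<lambda>\<omega>. P (\<lambda>i. \<eta> i \<omega>)) (count_space UNIV) (\<lambda>\<omega>. Q (\<lambda>i. \<eta> i \<omega>))"
    by (rule indep_var_blocks[OF assms(1-4)]) (fact assms)+
  from indep_varD[OF this, of "{True}" "{True}"] show ?thesis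
    by (auto simp: vimage_def Int_def conj_ac)
qed

lemma indep_vars_reindex:
  assumes "indep_vars N X (f ` I)" "inj_on f I"
  shows "indep_vars (\<lambda>i. N (f i)) (\<lambda>i. X (f i)) I"
proof -
  have "indep_sets (\<lambda>i. {X (f i) -` A \<inter> space M | A. A \<in> sets (N (f i))}) I"
    (is "indep_sets (\<lambda>i. ?F (f i)) I")
  proof (rule indep_setsI)
    fix i assume "i \<in> I"
    then have "random_variable (N (f i)) (X (f i))" using assms(1) by (simp add: indep_vars_def2)
    then show "?F (f i) \<subseteq> events" by (auto intro: measurable_sets)
  next
    fix A J assume J: "J \<noteq> {}" "J \<subseteq> I" "finite J" and A: "\<forall>j\<in>J. A j \<in> ?F (f j)"
    have inj: "inj_on f J" using J assms(2) by (auto intro: inj_on_subset)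
    have ind: "indep_sets ?F (f ` I)" using assms(1) by (simp add: indep_vars_def2)
    have "prob (\<Inter>j\<in>f ` J. A (the_inv_into J f j)) = (\<Prod>j\<in>f ` J. prob (A (the_inv_into J f j)))"
    proof (rule indep_setsD[OF ind])
      show "f ` J \<subseteq> f ` I" "f ` J \<noteq> {}" "finite (f ` J)" using J by auto
      show "\<forall>j\<in>f ` J. A (the_inv_into J f j) \<in> {X j -` A \<inter> space M | A. A \<in> sets (N j)}"
        using A by (simp add: the_inv_into_f_f inj)
    qed
    also have "(\<Inter>j\<in>f ` J. A (the_inv_into J f j)) = (\<Inter>j\<in>J. A j)"
      using inj by (simp add: the_inv_into_f_f)
    also have "(\<Prod>j\<in>f ` J. prob (A (the_inv_into J f j))) = (\<Prod>j\<in>J. prob (A j))"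
      by (subst prod.reindex[OF inj]) (simp add: the_inv_into_f_f inj)
    finally show "prob (\<Inter>j\<in>J. A j) = (\<Prod>j\<in>J. prob (A j))" .
  qed
  moreover have "random_variable (N (f i)) (X (f i))" if "i \<in> I" for i
    using assms(1) that by (simp add: indep_vars_def2)
  ultimately show ?thesis by (simp add: indep_vars_def2)
qed
end

section \<open>The Cramer exponent and first entrances\<close>

locale cramer_walk = prob_space M for M :: "'a measure" +
  fixes \<nu> :: "real measure" and \<theta> :: real
  assumes prob_nu: "prob_space \<nu>" and sets_nu: "sets \<nu> = sets borel"
    and theta_pos: "\<theta> > 0"
    and theta_int: "integrable \<nu> (\<lambda>x. exp (\<theta> * x))"
    and theta_eq: "(\<integral>x. exp (\<theta> * x) \<partial>\<nu>) = 1"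
    and mean_int: "integrable \<nu> (\<lambda>x. x)" and mean_neg: "(\<integral>x. x \<partial>\<nu>) < 0"
begin

definition mgf :: "real \<Rightarrow> real" where
  "mgf t = (\<integral>x. exp (t * x) \<partial>\<nu>)"

text \<open>Measurability of all coordinates, together with independence and the common law on the first \<open>n\<close>
only, is what survives shifting, reversing and truncating the step sequence.\<close>
definition iid :: "nat \<Rightarrow> (nat \<Rightarrow> 'a \<Rightarrow> real) \<Rightarrow> bool" where
  "iid n \<eta> \<longleftrightarrow> (\<forall>i. \<eta> i \<in> borel_measurable M) \<and> indep_vars (\<lambda>_. borel) \<eta> {1..n}
     \<and> (\<forall>i\<in>{1..n}. distr M borel (\<eta> i) = \<nu>)"

lemma mgf_integrable:
  assumes "0 \<le> t" "t \<le> \<theta>"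
  shows "integrable \<nu> (\<lambda>x. exp (t * x))"
proof (rule Bochner_Integration.integrable_bound)
  interpret nu: prob_space \<nu> by (rule prob_nu)
  show "integrable \<nu> (\<lambda>x. 1 + exp (\<theta> * x))" using theta_int by auto
  show "(\<lambda>x. exp (t * x)) \<in> borel_measurable \<nu>"
    using sets_nu by (auto cong: measurable_cong_sets)
  have "exp (t * x) \<le> 1 + exp (\<theta> * x)" for x
  proof (cases "0 \<le> x")
    case True
    then have "exp (t * x) \<le> exp (\<theta> * x)" using assms by (simp add: mult_right_mono)
    then show ?thesis by linarith
  next
    case False
    then have "exp (t * x) \<le> 1" using assms by (simp add: mult_nonneg_nonpos)
    then show ?thesis using exp_ge_zero[of "\<theta> * x"] by linarith
  qed
  then show "AE x in \<nu>. norm (exp (t * x)) \<le> norm (1 + exp (\<theta> * x))" by simp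
qed

lemma mgf_nonneg: "0 \<le> mgf t"
  unfolding mgf_def by (intro Bochner_Integration.integral_nonneg) auto

text \<open>The moment generating function is strictly convex unless the law is a point mass at 0, which the
negative mean excludes; it equals 1 at both \<open>0\<close> and \<open>\<theta>\<close>. Strict convexity appears pointwise below: the
gap \<open>f x\<close> between chord and curve vanishes only at \<open>x = 0\<close>.\<close>
lemma mgf_less_1:
  assumes "0 < t" "t < \<theta>" shows "mgf t < 1"
proof -
  interpret nu: prob_space \<nu> by (rule prob_nu)
  define s where "s = t / \<theta>"
  have s: "0 < s" "s < 1" "s * \<theta> = t" using assms theta_pos by (auto simp: s_def)
  have strict: "exp (s * z) < (1 - s) + s * exp z" if "z \<noteq> 0" for z :: real
  proof -
    have e: "exp w > 1 + w" if "w \<noteq> 0" for w :: real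
      using exp_minus_greater[of "-w"] that by simp
    \<comment> \<open>Convexity from the tangent at the intermediate point, factored as \<open>exp (s * z)\<close>.\<close>
    have "exp ((1 - s) * z) > 1 + (1 - s) * z" "exp (- s * z) > 1 + (- s * z)"
      using s that by (intro e; simp)+
    then have "exp (s * z) * (s * (1 + (1 - s) * z) + (1 - s) * (1 + (- s * z)))
        < exp (s * z) * (s * exp ((1 - s) * z) + (1 - s) * exp (- s * z))"
      using s by (intro mult_strict_left_mono add_strict_mono) auto
    also have "\<dots> = s * (exp (s * z) * exp ((1 - s) * z)) + (1 - s) * (exp (s * z) * exp (- s * z))"
      by (simp add: algebra_simps)
    also have "\<dots> = s * exp z + (1 - s)"
    proof -
      have "exp (s * z) * exp ((1 - s) * z) = exp z" "exp (s * z) * exp (- s * z) = 1"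
        unfolding exp_add[symmetric] by (simp_all add: left_diff_distrib)
      then show ?thesis by simp
    qed
    also have "exp (s * z) * (s * (1 + (1 - s) * z) + (1 - s) * (1 + (- s * z))) = exp (s * z)"
      by (simp add: algebra_simps)
    finally show ?thesis by simp
  qed
  define f where "f x = (1 - s) + s * exp (\<theta> * x) - exp (t * x)" for x
  have f_pos: "f x > 0" if "x \<noteq> 0" for x
  proof -
    have eq: "s * (\<theta> * x) = t * x" using s(3) by (metis mult.assoc)
    show ?thesis using strict[of "\<theta> * x", unfolded eq] that theta_pos by (simp add: f_def)
  qed
  have f_nonneg: "f x \<ge> 0" for x
    using f_pos[of x] by (cases "x = 0") (auto simp: f_def)
  have int_t: "integrable \<nu> (\<lambda>x. exp (t * x))" using mgf_integrable[of t] assms by simp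
  have int_f: "integrable \<nu> f"
    unfolding f_def using theta_int int_t by auto
  have eq: "(\<integral>x. f x \<partial>\<nu>) = 1 - mgf t"
    unfolding f_def mgf_def using theta_int int_t theta_eq
    by (simp add: nu.prob_space)
  have "(\<integral>x. f x \<partial>\<nu>) \<noteq> 0"
  proof
    assume "(\<integral>x. f x \<partial>\<nu>) = 0"
    then have "AE x in \<nu>. f x = 0"
      using integral_nonneg_eq_0_iff_AE[OF int_f] f_nonneg by simp
    then have "AE x in \<nu>. x = 0" by (rule AE_mp) (metis (mono_tags) AE_I2 f_pos less_irrefl)
    then have "(\<integral>x. x \<partial>\<nu>) = (\<integral>x. 0 \<partial>\<nu>)"
      using borel_measurable_integrable[OF mean_int] by (intro integral_cong_AE) simp_all
    then show False using mean_neg by simp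
  qed
  moreover have "(\<integral>x. f x \<partial>\<nu>) \<ge> 0" using f_nonneg by (intro Bochner_Integration.integral_nonneg) auto
  ultimately show ?thesis using eq by linarith
qed

lemma iid_measurable: "iid n \<eta> \<Longrightarrow> (\<lambda>\<omega>. (\<lambda>i. \<eta> i \<omega>)) \<in> measurable M seqM"
  by (intro measurable_PiM_single') (auto simp: iid_def)

lemma iid_single:
  assumes "iid n \<eta>" "i \<in> {1..n}" and t: "0 \<le> t" "t \<le> \<theta>"
  shows "integrable M (\<lambda>\<omega>. exp (t * \<eta> i \<omega>))" "expectation (\<lambda>\<omega>. exp (t * \<eta> i \<omega>)) = mgf t"
proof -
  have [measurable]: "\<eta> i \<in> borel_measurable M" and d: "distr M borel (\<eta> i) = \<nu>"
    using assms by (auto simp: iid_def)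
  show "integrable M (\<lambda>\<omega>. exp (t * \<eta> i \<omega>))"
    using mgf_integrable[OF t] unfolding d[symmetric] by (subst (asm) integrable_distr_eq) auto
  show "expectation (\<lambda>\<omega>. exp (t * \<eta> i \<omega>)) = mgf t"
    unfolding mgf_def by (subst d[symmetric], subst integral_distr) auto
qed

lemma iid_walk:
  assumes iid: "iid n \<eta>" and "m \<le> n" and t: "0 \<le> t" "t \<le> \<theta>"
  shows "integrable M (\<lambda>\<omega>. exp (t * walk (\<lambda>i. \<eta> i \<omega>) k m))"
    and "expectation (\<lambda>\<omega>. exp (t * walk (\<lambda>i. \<eta> i \<omega>) k m)) = mgf t ^ (m - k)"
proof -
  let ?J = "{k<..m}"
  have "indep_vars (\<lambda>_. borel) \<eta> {1..n}" using iid by (simp add: iid_def)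
  then have "indep_vars (\<lambda>_. borel) \<eta> ?J" by (rule indep_vars_subset) (use \<open>m \<le> n\<close> in auto)
  then have ind: "indep_vars (\<lambda>_. borel) (\<lambda>i \<omega>. exp (t * \<eta> i \<omega>)) ?J"
    by (rule indep_vars_compose2[where Y = "\<lambda>i x. exp (t * x)"]) auto
  have int: "integrable M (\<lambda>\<omega>. exp (t * \<eta> i \<omega>))" if "i \<in> ?J" for i
    using that \<open>m \<le> n\<close> by (intro iid_single(1)[OF iid _ t]) auto
  have eq: "exp (t * walk (\<lambda>i. \<eta> i \<omega>) k m) = (\<Prod>i\<in>?J. exp (t * \<eta> i \<omega>))" for \<omega>
    by (simp add: walk_def sum_distrib_left exp_sum)
  show "integrable M (\<lambda>\<omega>. exp (t * walk (\<lambda>i. \<eta> i \<omega>) k m))"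
    unfolding eq by (rule indep_vars_integrable[OF _ ind int]) simp_all
  have "expectation (\<lambda>\<omega>. exp (t * walk (\<lambda>i. \<eta> i \<omega>) k m)) = (\<Prod>i\<in>?J. expectation (\<lambda>\<omega>. exp (t * \<eta> i \<omega>)))"
    unfolding eq by (rule indep_vars_lebesgue_integral[OF _ ind int]) simp_all
  also have "\<dots> = (\<Prod>i\<in>?J. mgf t)"
    using \<open>m \<le> n\<close> by (intro prod.cong iid_single(2)[OF iid _ t]) auto
  finally show "expectation (\<lambda>\<omega>. exp (t * walk (\<lambda>i. \<eta> i \<omega>) k m)) = mgf t ^ (m - k)" by simp
qed

text \<open>Lundberg's inequality. The sequence \<open>exp (\<theta> S\<^sub>n)\<close> is a martingale of mean 1, and on the event that
\<open>I\<close> is first entered at time \<open>t\<close> its value at that time is at least \<open>exp (\<theta> b)\<close>. Since those events are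
disjoint, their total weighted probability is at most the mean at time \<open>n\<close>.\<close>
lemma first_in_sum_le:
  assumes iid: "iid n \<eta>" and I: "I \<subseteq> {b..}" "I \<in> sets borel"
  shows "(\<Sum>t\<le>n. \<P>(\<omega> in M. first_in I t (\<lambda>i. \<eta> i \<omega>))) \<le> exp (- \<theta> * b)"
proof -
  note [measurable] = iid_measurable[OF iid] I(2)
  let ?X = "\<lambda>\<omega> i. \<eta> i \<omega>"
  have th: "0 \<le> \<theta>" "\<theta> \<le> \<theta>" using theta_pos by auto
  have mgf1: "mgf \<theta> = 1" by (simp add: mgf_def theta_eq)
  define h where "h t x = (if first_in I t x then exp (\<theta> * walk x 0 t) else 0)" for t x
  define g where "g t x = (if first_in I t x then exp (\<theta> * walk x 0 n) else 0)" for t x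
  have hm [measurable]: "h t \<in> borel_measurable seqM" for t unfolding h_def[abs_def] by measurable
  have gm [measurable]: "g t \<in> borel_measurable seqM" for t unfolding g_def[abs_def] by measurable
  have int_n: "integrable M (\<lambda>\<omega>. exp (\<theta> * walk (?X \<omega>) 0 n))"
    by (rule iid_walk(1)[OF iid _ th]) simp
  have int_g: "integrable M (\<lambda>\<omega>. g t (?X \<omega>))" for t
    by (rule Bochner_Integration.integrable_bound[OF int_n]) (auto simp: g_def)
  have step: "exp (\<theta> * b) * \<P>(\<omega> in M. first_in I t (?X \<omega>)) \<le> expectation (\<lambda>\<omega>. g t (?X \<omega>))" if "t \<le> n" for t
  proof -
    have int_h: "integrable M (\<lambda>\<omega>. h t (?X \<omega>))"
      by (rule Bochner_Integration.integrable_bound[OF iid_walk(1)[OF iid that th, of 0]]) (auto simp: h_def)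
    have "indep_var borel (\<lambda>\<omega>. h t (?X \<omega>)) borel (\<lambda>\<omega>. exp (\<theta> * walk (?X \<omega>) t n))"
    proof (rule indep_var_blocks[where A = "{1..t}" and B = "{t<..n}" and F = "h t" and G = "\<lambda>x. exp (\<theta> * walk x t n)"])
      show "indep_vars (\<lambda>_. borel) \<eta> {1..n}" using iid by (simp add: iid_def)
      show "(\<lambda>x. exp (\<theta> * walk x t n)) \<in> borel_measurable seqM" by measurable
      fix x y :: "nat \<Rightarrow> real"
      show "h t x = h t y" if "\<And>i. i \<in> {1..t} \<Longrightarrow> x i = y i"
      proof -
        have "walk x 0 s = walk y 0 s" if "s \<le> t" for s
          using that by (intro walk_cong) (use \<open>\<And>i. i \<in> {1..t} \<Longrightarrow> x i = y i\<close> in auto)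
        then show ?thesis by (auto simp: h_def first_in_def)
      qed
      show "exp (\<theta> * walk x t n) = exp (\<theta> * walk y t n)" if "\<And>i. i \<in> {t<..n} \<Longrightarrow> x i = y i"
        by (intro arg_cong[where f = "\<lambda>w. exp (\<theta> * w)"] walk_cong that) simp
      show "{1..t} \<subseteq> {1..n}" using \<open>t \<le> n\<close> by simp
    qed (use hm in auto)
    from indep_var_lebesgue_integral[OF this int_h iid_walk(1)[OF iid _ th]]
    have "expectation (\<lambda>\<omega>. h t (?X \<omega>) * exp (\<theta> * walk (?X \<omega>) t n)) = expectation (\<lambda>\<omega>. h t (?X \<omega>))"
      by (simp add: iid_walk(2)[OF iid _ th] mgf1)
    also have "(\<lambda>\<omega>. h t (?X \<omega>) * exp (\<theta> * walk (?X \<omega>) t n)) = (\<lambda>\<omega>. g t (?X \<omega>))"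
    proof
      fix \<omega>
      have "walk (?X \<omega>) 0 t + walk (?X \<omega>) t n = walk (?X \<omega>) 0 n"
        using \<open>t \<le> n\<close> by (intro walk_append) auto
      then have "exp (\<theta> * walk (?X \<omega>) 0 t) * exp (\<theta> * walk (?X \<omega>) t n) = exp (\<theta> * walk (?X \<omega>) 0 n)"
        by (metis exp_add distrib_left)
      then show "h t (?X \<omega>) * exp (\<theta> * walk (?X \<omega>) t n) = g t (?X \<omega>)"
        by (simp add: h_def g_def)
    qed
    finally have eq: "expectation (\<lambda>\<omega>. g t (?X \<omega>)) = expectation (\<lambda>\<omega>. h t (?X \<omega>))" .
    have "exp (\<theta> * b) * \<P>(\<omega> in M. first_in I t (?X \<omega>))
        = expectation (\<lambda>\<omega>. exp (\<theta> * b) * indicator {\<omega>\<in>space M. first_in I t (?X \<omega>)} \<omega>)"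
      by simp
    also have "\<dots> \<le> expectation (\<lambda>\<omega>. h t (?X \<omega>))"
    proof (rule integral_mono[OF _ int_h])
      show "integrable M (\<lambda>\<omega>. exp (\<theta> * b) * indicator {\<omega>\<in>space M. first_in I t (?X \<omega>)} \<omega>)"
        by (intro integrable_mult_right integrable_real_indicator) (auto simp: emeasure_eq_measure)
    qed (use I theta_pos in \<open>auto simp: h_def first_in_def indicator_def\<close>)
    finally show ?thesis using eq by simp
  qed
  have "exp (\<theta> * b) * (\<Sum>t\<le>n. \<P>(\<omega> in M. first_in I t (?X \<omega>))) \<le> (\<Sum>t\<le>n. expectation (\<lambda>\<omega>. g t (?X \<omega>)))"
    unfolding sum_distrib_left by (intro sum_mono step) auto
  also have "\<dots> = expectation (\<lambda>\<omega>. \<Sum>t\<le>n. g t (?X \<omega>))" by (simp add: int_g)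
  also have "\<dots> \<le> expectation (\<lambda>\<omega>. exp (\<theta> * walk (?X \<omega>) 0 n))"
  proof (rule integral_mono)
    fix \<omega>
    show "(\<Sum>t\<le>n. g t (?X \<omega>)) \<le> exp (\<theta> * walk (?X \<omega>) 0 n)"
    proof (cases "\<exists>t\<le>n. first_in I t (?X \<omega>)")
      case True
      then obtain t where t: "t \<le> n" "first_in I t (?X \<omega>)" by auto
      have "s = t" if "first_in I s (?X \<omega>)" for s
        using t(2) that unfolding first_in_def by (cases s t rule: linorder_cases) auto
      then have "g s (?X \<omega>) = 0" if "s \<noteq> t" for s using that by (auto simp: g_def)
      then have "(\<Sum>s\<le>n. g s (?X \<omega>)) = g t (?X \<omega>)"
        using t by (subst sum.remove[of _ t]) (auto intro: sum.neutral)
      then show ?thesis by (simp add: g_def)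
    next
      case False
      then have "(\<Sum>s\<le>n. g s (?X \<omega>)) = 0" by (intro sum.neutral) (auto simp: g_def)
      then show ?thesis by simp
    qed
  qed (use int_g int_n in auto)
  also have "\<dots> = 1" by (simp add: iid_walk(2)[OF iid _ th] mgf1)
  finally show ?thesis by (simp add: exp_minus field_simps)
qed

text \<open>Chernoff bound at the exponent \<open>\<theta> / 2\<close>, where the moment generating function is less than 1.\<close>
lemma walk_ge_prob:
  assumes iid: "iid n \<eta>" and "m \<le> n"
  shows "\<P>(\<omega> in M. walk (\<lambda>i. \<eta> i \<omega>) k m \<ge> - 1) \<le> exp (\<theta> / 2) * mgf (\<theta> / 2) ^ (m - k)"
proof -
  note [measurable] = iid_measurable[OF iid]
  have t: "0 \<le> \<theta> / 2" "\<theta> / 2 \<le> \<theta>" using theta_pos by auto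
  let ?u = "\<lambda>\<omega>. exp (\<theta> / 2 * walk (\<lambda>i. \<eta> i \<omega>) k m)"
  have "\<P>(\<omega> in M. walk (\<lambda>i. \<eta> i \<omega>) k m \<ge> - 1) \<le> \<P>(\<omega> in M. ?u \<omega> \<ge> exp (- (\<theta> / 2)))"
  proof (intro finite_measure_mono)
    have "- (\<theta> / 2) \<le> \<theta> / 2 * w" if "- 1 \<le> w" for w
      using mult_left_mono[OF that, of "\<theta> / 2"] theta_pos by simp
    then show "{\<omega> \<in> space M. walk (\<lambda>i. \<eta> i \<omega>) k m \<ge> - 1} \<subseteq> {\<omega> \<in> space M. ?u \<omega> \<ge> exp (- (\<theta> / 2))}"
      by auto
  qed measurable
  also have "\<dots> \<le> expectation ?u / exp (- (\<theta> / 2))"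
    by (rule integral_Markov_inequality_measure[OF iid_walk(1)[OF iid \<open>m \<le> n\<close> t], of "{}"]) auto
  finally show ?thesis
    unfolding iid_walk(2)[OF iid \<open>m \<le> n\<close> t] by (simp add: exp_minus field_simps)
qed

text \<open>Two visits to a unit interval at distance at least \<open>k\<close> cost a factor \<open>exp (- \<theta> b)\<close> for reaching
the interval at all, and an independent factor \<open>\<rho>\<^sup>k\<close> because after the first visit the walk
must, after \<open>k\<close> or more steps, have lost at most 1. Starting from the first visit, instead of from an arbitrary
one, is harmless since it only enlarges the time distance.\<close>
lemma visits_apart_prob:
  fixes b :: real
  assumes iid: "iid n \<eta>"
  defines "\<rho> \<equiv> mgf (\<theta> / 2)" and "I \<equiv> {b..<b + 1}"
  shows "\<P>(\<omega> in M. \<exists>t m. t + k \<le> m \<and> m \<le> n \<and> walk (\<lambda>i. \<eta> i \<omega>) 0 t \<in> I \<and> walk (\<lambda>i. \<eta> i \<omega>) 0 m \<in> I)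
     \<le> exp (\<theta> / 2) / (1 - \<rho>) * \<rho> ^ k * exp (- \<theta> * b)"
proof -
  note [measurable] = iid_measurable[OF iid]
  let ?X = "\<lambda>\<omega> i. \<eta> i \<omega>"
  have rho: "0 \<le> \<rho>" "\<rho> < 1"
    using mgf_nonneg mgf_less_1[of "\<theta> / 2"] theta_pos by (auto simp: \<rho>_def)
  have I [measurable]: "I \<in> sets borel" by (simp add: I_def)
  define R where "R t x \<longleftrightarrow> (\<exists>m\<in>{t+k..n}. walk x t m \<ge> - 1)" for t and x :: "nat \<Rightarrow> real"
  have R [measurable]: "Measurable.pred seqM (R t)" for t unfolding R_def[abs_def] by measurable
  define q where "q = exp (\<theta> / 2) / (1 - \<rho>) * \<rho> ^ k"
  have R_le: "\<P>(\<omega> in M. R t (?X \<omega>)) \<le> q" for t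
  proof -
    have "{\<omega>\<in>space M. R t (?X \<omega>)} = (\<Union>m\<in>{t+k..n}. {\<omega>\<in>space M. walk (?X \<omega>) t m \<ge> - 1})"
      by (auto simp: R_def)
    also have "prob \<dots> \<le> (\<Sum>m\<in>{t+k..n}. \<P>(\<omega> in M. walk (?X \<omega>) t m \<ge> - 1))"
      by (intro finite_measure_subadditive_finite) auto
    also have "\<dots> \<le> (\<Sum>m\<in>{t+k..n}. exp (\<theta> / 2) * \<rho> ^ (m - t))"
      unfolding \<rho>_def by (intro sum_mono walk_ge_prob[OF iid]) auto
    also have "\<dots> = exp (\<theta> / 2) * (\<Sum>j\<in>(\<lambda>m. m - t) ` {t+k..n}. \<rho> ^ j)"
      by (subst sum.reindex) (auto simp: sum_distrib_left inj_on_def)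
    also have "(\<Sum>j\<in>(\<lambda>m. m - t) ` {t+k..n}. \<rho> ^ j) \<le> (\<Sum>j. \<rho> ^ (j + k))"
    proof -
      have "(\<Sum>j\<in>(\<lambda>m. m - t) ` {t+k..n}. \<rho> ^ j) \<le> (\<Sum>j\<in>{k..k + n}. \<rho> ^ j)"
        using rho by (intro sum_mono2) auto
      also have "\<dots> = (\<Sum>j\<in>{0..n}. \<rho> ^ (j + k))"
        using sum.shift_bounds_cl_nat_ivl[of "\<lambda>j. \<rho> ^ j" 0 k n] by (simp add: add.commute)
      also have "\<dots> \<le> (\<Sum>j. \<rho> ^ (j + k))"
        using rho by (intro sum_le_suminf) (auto simp: power_add intro!: summable_mult2 summable_geometric)
      finally show ?thesis .
    qed
    also have "(\<Sum>j. \<rho> ^ (j + k)) = \<rho> ^ k / (1 - \<rho>)"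
      using rho by (simp add: power_add suminf_mult2[symmetric] summable_geometric suminf_geometric)
    finally show ?thesis by (simp add: q_def)
  qed
  have joint: "\<P>(\<omega> in M. first_in I t (?X \<omega>) \<and> R t (?X \<omega>)) = \<P>(\<omega> in M. first_in I t (?X \<omega>)) * \<P>(\<omega> in M. R t (?X \<omega>))"
    if "t \<le> n" for t
  proof (rule prob_blocks[where A = "{1..t}" and B = "{t<..n}"])
    show "indep_vars (\<lambda>_. borel) \<eta> {1..n}" using iid by (simp add: iid_def)
    show "first_in I t x = first_in I t y" if "\<And>i. i \<in> {1..t} \<Longrightarrow> x i = y i" for x y
    proof -
      have "walk x 0 s = walk y 0 s" if "s \<le> t" for s
        by (rule walk_cong, rule \<open>\<And>i. i \<in> {1..t} \<Longrightarrow> x i = y i\<close>) (use that in auto)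
      then show ?thesis by (simp add: first_in_def)
    qed
    show "R t x = R t y" if "\<And>i. i \<in> {t<..n} \<Longrightarrow> x i = y i" for x y
    proof -
      have "walk x t m = walk y t m" if "m \<le> n" for m
        by (rule walk_cong, rule \<open>\<And>i. i \<in> {t<..n} \<Longrightarrow> x i = y i\<close>) (use that in auto)
      then show ?thesis by (simp add: R_def)
    qed
  qed (use \<open>t \<le> n\<close> in auto)
  have "{\<omega>\<in>space M. \<exists>t m. t + k \<le> m \<and> m \<le> n \<and> walk (?X \<omega>) 0 t \<in> I \<and> walk (?X \<omega>) 0 m \<in> I}
      \<subseteq> (\<Union>t\<in>{..n}. {\<omega>\<in>space M. first_in I t (?X \<omega>) \<and> R t (?X \<omega>)})"
  proof safe
    fix \<omega> t m assume h: "\<omega> \<in> space M" "t + k \<le> m" "m \<le> n" "walk (?X \<omega>) 0 t \<in> I" "walk (?X \<omega>) 0 m \<in> I"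
    define t0 where "t0 = (LEAST t. walk (?X \<omega>) 0 t \<in> I)"
    have t0: "walk (?X \<omega>) 0 t0 \<in> I" "t0 \<le> t" unfolding t0_def
      using h(4) by (auto intro: LeastI Least_le)
    have "first_in I t0 (?X \<omega>)" unfolding first_in_def using t0(1) not_less_Least unfolding t0_def by blast
    moreover have "walk (?X \<omega>) t0 m \<ge> - 1"
      using walk_append[of 0 t0 m "?X \<omega>"] t0 h unfolding I_def by simp
    then have "R t0 (?X \<omega>)" using t0 h by (auto simp: R_def intro!: bexI[of _ m])
    ultimately show "\<omega> \<in> (\<Union>t\<in>{..n}. {\<omega>\<in>space M. first_in I t (?X \<omega>) \<and> R t (?X \<omega>)})"
      using h t0 by auto
  qed
  then have "\<P>(\<omega> in M. \<exists>t m. t + k \<le> m \<and> m \<le> n \<and> walk (?X \<omega>) 0 t \<in> I \<and> walk (?X \<omega>) 0 m \<in> I)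
      \<le> prob (\<Union>t\<in>{..n}. {\<omega>\<in>space M. first_in I t (?X \<omega>) \<and> R t (?X \<omega>)})"
    by (intro finite_measure_mono) auto
  also have "\<dots> \<le> (\<Sum>t\<le>n. \<P>(\<omega> in M. first_in I t (?X \<omega>) \<and> R t (?X \<omega>)))"
    by (intro finite_measure_subadditive_finite) auto
  also have "\<dots> = (\<Sum>t\<le>n. \<P>(\<omega> in M. first_in I t (?X \<omega>)) * \<P>(\<omega> in M. R t (?X \<omega>)))"
    by (intro sum.cong joint) auto
  also have "\<dots> \<le> (\<Sum>t\<le>n. \<P>(\<omega> in M. first_in I t (?X \<omega>)) * q)"
    by (intro sum_mono mult_left_mono R_le) auto
  also have "\<dots> = q * (\<Sum>t\<le>n. \<P>(\<omega> in M. first_in I t (?X \<omega>)))"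
    by (simp add: sum_distrib_left mult.commute)
  also have "\<dots> \<le> q * exp (- \<theta> * b)"
    using rho by (intro mult_left_mono first_in_sum_le[OF iid]) (auto simp: I_def q_def)
  finally show ?thesis by (simp add: q_def)
qed

lemma walk_max_prob:
  assumes iid: "iid n \<eta>"
  shows "\<P>(\<omega> in M. \<exists>m\<le>n. walk (\<lambda>i. \<eta> i \<omega>) 0 m \<ge> b) \<le> exp (- \<theta> * b)"
proof -
  note [measurable] = iid_measurable[OF iid]
  let ?X = "\<lambda>\<omega> i. \<eta> i \<omega>"
  have "{\<omega>\<in>space M. \<exists>m\<le>n. walk (?X \<omega>) 0 m \<ge> b} \<subseteq> (\<Union>t\<in>{..n}. {\<omega>\<in>space M. first_in {b..} t (?X \<omega>)})"
  proof safe
    fix \<omega> m assume h: "\<omega> \<in> space M" "m \<le> n" "walk (?X \<omega>) 0 m \<ge> b"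
    define t0 where "t0 = (LEAST t. walk (?X \<omega>) 0 t \<in> {b..})"
    have t0: "walk (?X \<omega>) 0 t0 \<in> {b..}" "t0 \<le> m" unfolding t0_def
      using h(3) by (auto intro: LeastI Least_le)
    have "first_in {b..} t0 (?X \<omega>)" unfolding first_in_def using t0(1) not_less_Least unfolding t0_def by blast
    then show "\<omega> \<in> (\<Union>t\<in>{..n}. {\<omega>\<in>space M. first_in {b..} t (?X \<omega>)})" using h t0 by auto
  qed
  then have "\<P>(\<omega> in M. \<exists>m\<le>n. walk (?X \<omega>) 0 m \<ge> b) \<le> prob (\<Union>t\<in>{..n}. {\<omega>\<in>space M. first_in {b..} t (?X \<omega>)})"
    by (intro finite_measure_mono) auto
  also have "\<dots> \<le> (\<Sum>t\<le>n. \<P>(\<omega> in M. first_in {b..} t (?X \<omega>)))"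
    by (intro finite_measure_subadditive_finite) auto
  also have "\<dots> \<le> exp (- \<theta> * b)" by (intro first_in_sum_le[OF iid]) auto
  finally show ?thesis .
qed
end

section \<open>The tail of a perpetuity\<close>

text \<open>If the visits to the unit interval \<open>j\<close> levels below \<open>ln u\<close> happen within a time window of
length \<open>q (j + 1)\<close>, they contribute at most \<open>q (j + 1) u exp (- j)\<close>, and these contributions add up to a
multiple of \<open>u\<close>.\<close>
lemma perpetuity_le_of_sparse_visits:
  fixes x :: "nat \<Rightarrow> real"
  assumes u: "u > 0" and below: "\<And>m. m \<le> n \<Longrightarrow> walk x 0 m < ln u"
    and sparse: "\<And>j t m. t + q * (j + 1) \<le> m \<Longrightarrow> m \<le> n \<Longrightarrow> walk x 0 t \<in> {ln u - real j - 1..<ln u - real j - 1 + 1}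
      \<Longrightarrow> walk x 0 m \<in> {ln u - real j - 1..<ln u - real j - 1 + 1} \<Longrightarrow> False"
  shows "perpetuity x 0 n \<le> real q * u / (1 - exp (- 1))\<^sup>2"
proof -
  define J where "J m = nat (\<lceil>ln u - walk x 0 m\<rceil> - 1)" for m
  have J: "ln u - real (J m) - 1 \<le> walk x 0 m" "walk x 0 m < ln u - real (J m)" if "m \<le> n" for m
  proof -
    have "0 < \<lceil>ln u - walk x 0 m\<rceil>" using below[OF that] by simp
    then have "real (J m) = real_of_int \<lceil>ln u - walk x 0 m\<rceil> - 1" by (simp add: J_def)
    then show "ln u - real (J m) - 1 \<le> walk x 0 m" "walk x 0 m < ln u - real (J m)" by linarith+
  qed
  have sums: "(\<lambda>j. real (Suc j) * exp (- 1) ^ j) sums (1 / (1 - exp (- 1 :: real))\<^sup>2)"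
    using geometric_deriv_sums[of "exp (- 1 :: real)"] by simp
  have "perpetuity x 0 n = (\<Sum>j\<in>J ` {0..n}. \<Sum>m\<in>{m\<in>{0..n}. J m = j}. exp (walk x 0 m))"
    unfolding perpetuity_def by (rule sum.image_gen) simp
  also have "\<dots> \<le> (\<Sum>j\<in>J ` {0..n}. real q * u * (real (Suc j) * exp (- 1) ^ j))"
  proof (rule sum_mono)
    fix j assume "j \<in> J ` {0..n}"
    let ?A = "{m\<in>{0..n}. J m = j}"
    define t where "t = Min ?A"
    have A: "finite ?A" "?A \<noteq> {}" using \<open>j \<in> J ` {0..n}\<close> by auto
    have t: "t \<in> ?A" unfolding t_def by (rule Min_in[OF A])
    have "?A \<subseteq> {t..<t + q * (j + 1)}"
    proof
      fix m assume m: "m \<in> ?A"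
      have "t \<le> m" unfolding t_def using A m by (intro Min_le) auto
      moreover have "\<not> t + q * (j + 1) \<le> m"
        using sparse[of t j m] J[of t] J[of m] m t by auto
      ultimately show "m \<in> {t..<t + q * (j + 1)}" by simp
    qed
    then have "card ?A \<le> card {t..<t + q * (j + 1)}" by (intro card_mono) auto
    then have card: "card ?A \<le> q * (j + 1)" by simp
    have "(\<Sum>m\<in>?A. exp (walk x 0 m)) \<le> real (card ?A) * (u * exp (- 1) ^ j)"
    proof (rule sum_bounded_above)
      fix m assume m: "m \<in> ?A"
      then have "exp (walk x 0 m) \<le> exp (ln u - real j)" using J[of m] by auto
      also have "\<dots> = u * exp (- 1) ^ j"
        using u by (simp add: exp_diff exp_minus exp_of_nat_mult[symmetric] field_simps)
      finally show "exp (walk x 0 m) \<le> u * exp (- 1) ^ j" .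
    qed
    also have "\<dots> \<le> real (q * (j + 1)) * (u * exp (- 1) ^ j)"
      using card u by (intro mult_right_mono) (auto simp del: of_nat_mult)
    finally show "(\<Sum>m\<in>?A. exp (walk x 0 m)) \<le> real q * u * (real (Suc j) * exp (- 1) ^ j)"
      by (simp add: algebra_simps)
  qed
  also have "\<dots> = real q * u * (\<Sum>j\<in>J ` {0..n}. real (Suc j) * exp (- 1) ^ j)"
    by (rule sum_distrib_left[symmetric])
  also have "\<dots> \<le> real q * u * (\<Sum>j. real (Suc j) * exp (- 1) ^ j)"
    using u sums by (intro mult_left_mono sum_le_suminf) (auto simp: sums_iff)
  also have "(\<Sum>j. real (Suc j) * exp (- 1) ^ j) = 1 / (1 - exp (- 1 :: real))\<^sup>2"
    using sums by (rule sums_unique[symmetric])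
  finally show ?thesis by simp
qed

context cramer_walk begin

text \<open>The perpetuity has the same tail exponent as the maximum of its terms. Windows growing only linearly in the
depth \<open>j\<close> suffice: the level \<open>ln u - j - 1\<close> is reached with probability at most
\<open>u powr (- \<theta>) * exp (\<theta> (j + 1))\<close>, and if \<open>\<rho>\<^sup>q exp \<theta> \<le> 1/2\<close> the cost of overstaying the window beats
the factor \<open>exp (\<theta> (j + 1))\<close> geometrically. The constant does not depend on the number of terms.\<close>
lemma perpetuity_tail:
  "\<exists>C\<ge>0. \<forall>n \<eta> u. iid n \<eta> \<and> u > 0 \<longrightarrow> \<P>(\<omega> in M. perpetuity (\<lambda>i. \<eta> i \<omega>) 0 n \<ge> u) \<le> C * u powr (- \<theta>)"
proof -
  define \<rho> where "\<rho> = mgf (\<theta> / 2)"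
  have rho: "0 \<le> \<rho>" "\<rho> < 1"
    using mgf_nonneg mgf_less_1[of "\<theta> / 2"] theta_pos by (auto simp: \<rho>_def)
  obtain q0 where q0: "\<rho> ^ q0 < exp (- \<theta>) / 2"
    using real_arch_pow_inv[of "exp (- \<theta>) / 2" \<rho>] rho by auto
  define q where "q = Suc q0"
  have "\<rho> ^ q \<le> \<rho> ^ q0" unfolding q_def using rho by (intro power_decreasing) auto
  then have "\<rho> ^ q * exp \<theta> \<le> exp (- \<theta>) / 2 * exp \<theta>" using q0 by (intro mult_right_mono) auto
  then have q: "\<rho> ^ q * exp \<theta> \<le> 1 / 2" by (simp add: exp_minus)
  define K where "K = exp (\<theta> / 2) / (1 - \<rho>)"
  have K: "K \<ge> 0" using rho by (simp add: K_def)
  define L where "L = 2 * real q / (1 - exp (- 1 :: real))\<^sup>2"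
  have "exp (- 1 :: real) < 1" by simp
  then have L: "L > 0" unfolding L_def q_def by simp
  have main: "\<P>(\<omega> in M. perpetuity (\<lambda>i. \<eta> i \<omega>) 0 n \<ge> L * u) \<le> (1 + K) * u powr (- \<theta>)"
    if iid: "iid n \<eta>" and u: "u > 0" for n \<eta> u
  proof -
    note [measurable] = iid_measurable[OF iid]
    let ?X = "\<lambda>\<omega> i. \<eta> i \<omega>"
    define V where "V j = {\<omega>\<in>space M. \<exists>t m. t + q * (j + 1) \<le> m \<and> m \<le> n
       \<and> walk (?X \<omega>) 0 t \<in> {ln u - real j - 1..<ln u - real j - 1 + 1}
       \<and> walk (?X \<omega>) 0 m \<in> {ln u - real j - 1..<ln u - real j - 1 + 1}}" for j
    define H where "H = {\<omega>\<in>space M. \<exists>m\<le>n. walk (?X \<omega>) 0 m \<ge> ln u}"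
    have [measurable]: "V j \<in> events" for j unfolding V_def by measurable
    have [measurable]: "H \<in> events" unfolding H_def by measurable
    have V_le: "prob (V j) \<le> K * u powr (- \<theta>) * (1 / 2) ^ Suc j" for j
    proof -
      have "prob (V j) \<le> K * \<rho> ^ (q * (j + 1)) * exp (- \<theta> * (ln u - real j - 1))"
        unfolding V_def K_def \<rho>_def by (rule visits_apart_prob[OF iid])
      also have "exp (- \<theta> * (ln u - real j - 1)) = u powr (- \<theta>) * exp \<theta> ^ Suc j"
        using u by (simp add: powr_def exp_of_nat_mult[symmetric] exp_add[symmetric] algebra_simps)
      also have "K * \<rho> ^ (q * (j + 1)) * (u powr (- \<theta>) * exp \<theta> ^ Suc j) = K * u powr (- \<theta>) * (\<rho> ^ q * exp \<theta>) ^ Suc j"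
      proof -
        have "\<rho> ^ (q * (j + 1)) = (\<rho> ^ q) ^ Suc j" by (simp only: power_mult Suc_eq_plus1)
        then show ?thesis by (simp only: power_mult_distrib ac_simps)
      qed
      also have "\<dots> \<le> K * u powr (- \<theta>) * (1 / 2) ^ Suc j"
        using K rho by (intro mult_left_mono power_mono q) auto
      finally show ?thesis .
    qed
    have half: "(\<lambda>j. K * u powr (- \<theta>) * (1 / 2) ^ Suc j) sums (K * u powr (- \<theta>) * 1)"
      by (intro sums_mult power_half_series)
    have sum_V: "summable (\<lambda>j. prob (V j))"
      by (rule summable_comparison_test'[OF sums_summable[OF half]]) (use V_le in auto)
    have "{\<omega>\<in>space M. perpetuity (?X \<omega>) 0 n \<ge> L * u} \<subseteq> H \<union> (\<Union>j. V j)"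
    proof safe
      fix \<omega> assume w: "\<omega> \<in> space M" "perpetuity (?X \<omega>) 0 n \<ge> L * u" "\<omega> \<notin> (\<Union>j. V j)"
      show "\<omega> \<in> H"
      proof (rule ccontr)
        assume "\<omega> \<notin> H"
        have "perpetuity (?X \<omega>) 0 n \<le> real q * u / (1 - exp (- 1))\<^sup>2"
        proof (rule perpetuity_le_of_sparse_visits[OF u])
          show "walk (?X \<omega>) 0 m < ln u" if "m \<le> n" for m
            using \<open>\<omega> \<notin> H\<close> w(1) that unfolding H_def by force
        qed (use w in \<open>unfold V_def, blast\<close>)
        also have "\<dots> = L * u / 2" by (simp add: L_def)
        finally show False using w(2) mult_pos_pos[OF L u] by linarith
      qed
    qed
    then have "\<P>(\<omega> in M. perpetuity (?X \<omega>) 0 n \<ge> L * u) \<le> prob (H \<union> (\<Union>j. V j))"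
      by (intro finite_measure_mono) auto
    also have "\<dots> \<le> prob H + prob (\<Union>j. V j)" by (intro measure_Un_le) auto
    also have "prob H \<le> exp (- \<theta> * ln u)" unfolding H_def by (rule walk_max_prob[OF iid])
    also have "exp (- \<theta> * ln u) = u powr (- \<theta>)" using u by (simp add: powr_def)
    also have "prob (\<Union>j. V j) \<le> (\<Sum>j. prob (V j))"
      by (intro finite_measure_subadditive_countably sum_V) auto
    also have "\<dots> \<le> (\<Sum>j. K * u powr (- \<theta>) * (1 / 2) ^ Suc j)"
      by (intro suminf_le V_le sum_V sums_summable[OF half])
    also have "\<dots> = K * u powr (- \<theta>)" using half by (simp add: sums_iff)
    finally show ?thesis by (simp add: algebra_simps)
  qed
  show ?thesis
  proof (intro exI[of _ "(1 + K) * L powr \<theta>"] conjI allI impI)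
    show "0 \<le> (1 + K) * L powr \<theta>" using K by simp
    fix n \<eta> and u :: real assume h: "iid n \<eta> \<and> u > 0"
    have "\<P>(\<omega> in M. perpetuity (\<lambda>i. \<eta> i \<omega>) 0 n \<ge> u) \<le> (1 + K) * (u / L) powr (- \<theta>)"
      using main[of n \<eta> "u / L"] h L by simp
    also have "\<dots> = (1 + K) * L powr \<theta> * u powr (- \<theta>)"
      using h L by (simp add: powr_divide powr_minus field_simps)
    finally show "\<P>(\<omega> in M. perpetuity (\<lambda>i. \<eta> i \<omega>) 0 n \<ge> u) \<le> (1 + K) * L powr \<theta> * u powr (- \<theta>)" .
  qed
qed
end

text \<open>Reversing the steps turns the affine recursion into a perpetuity, so both have the same tail.\<close>
lemma chain_eq_perpetuity_rev:
  assumes "1 \<le> m"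
  shows "affine_chain x m = perpetuity (\<lambda>i. x (m + 1 - i)) 0 (m - 1)"
proof -
  have w: "walk (\<lambda>i. x (m + 1 - i)) 0 (m - k) = walk x k m" if "k \<le> m" for k
    unfolding walk_def
    by (rule sum.reindex_bij_witness[of _ "\<lambda>i. m + 1 - i" "\<lambda>i. m + 1 - i"]) (use that in auto)
  show ?thesis unfolding affine_chain_def perpetuity_def
    by (rule sum.reindex_bij_witness[of _ "\<lambda>j. m - j" "\<lambda>k. m - k"]) (use assms w in auto)
qed

lemma perpetuity_shift:
  assumes "k \<le> n"
  shows "perpetuity x k n = perpetuity (\<lambda>i. x (k + i)) 0 (n - k)"
proof -
  have w: "walk (\<lambda>i. x (k + i)) 0 (m - k) = walk x k m" for m
    unfolding walk_def
    by (rule sum.reindex_bij_witness[of _ "\<lambda>i. i - k" "\<lambda>i. k + i"]) auto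
  show ?thesis unfolding perpetuity_def
    by (rule sum.reindex_bij_witness[of _ "\<lambda>j. k + j" "\<lambda>m. m - k"]) (use assms w in auto)
qed

lemma dyadic_bracket:
  fixes w v :: real
  assumes "w < v"
  shows "w < v * (1 / 2) ^ J \<or> (\<exists>j<J. v * (1 / 2) ^ Suc j \<le> w \<and> w < v * (1 / 2) ^ j)"
proof (induction J)
  case (Suc J)
  then show ?case by (metis less_Suc_eq not_le)
qed (use assms in simp)

lemma dyadic_truncation_le:
  fixes w u :: real
  assumes "0 \<le> w" "0 < u"
  shows "(if w < u then w else 0) \<le> u * (1 / 2) ^ J + (\<Sum>j<J. u * (1 / 2) ^ j * of_bool (w \<ge> u * (1 / 2) ^ Suc j))"
    (is "_ \<le> _ + (\<Sum>j<J. ?g j)")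
proof -
  have nonneg: "0 \<le> (\<Sum>j<J. ?g j)" using assms by (intro sum_nonneg) auto
  consider "w \<ge> u" | "w < u * (1 / 2) ^ J" | j where "j < J" "u * (1 / 2) ^ Suc j \<le> w" "w < u * (1 / 2) ^ j" "w < u"
    using dyadic_bracket[of w u J] by force
  then show ?thesis
  proof cases
    case 3
    then have "w \<le> ?g j" by simp
    also have "\<dots> \<le> (\<Sum>j<J. ?g j)"
      using 3 assms by (intro member_le_sum[where f = ?g]) auto
    also have "\<dots> \<le> u * (1 / 2) ^ J + \<dots>" using assms by simp
    finally show ?thesis using 3 by simp
  qed (use nonneg assms in \<open>auto intro: add_nonneg_nonneg\<close>)
qed

context cramer_walk begin

lemma iid_reindex:
  assumes iid: "iid n \<eta>" and f: "inj_on f {1..m}" "f ` {1..m} \<subseteq> {1..n}"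
  shows "iid m (\<lambda>i. \<eta> (f i))"
proof -
  have "indep_vars (\<lambda>_. borel) \<eta> (f ` {1..m})"
    using iid f(2) by (auto simp: iid_def intro: indep_vars_subset)
  from indep_vars_reindex[OF this f(1)] show ?thesis using iid f(2) by (auto simp: iid_def)
qed

lemma chain_and_perpetuity_tail:
  "\<exists>C\<ge>0. \<forall>n \<eta> m u. iid n \<eta> \<and> m \<le> n \<and> u > 0 \<longrightarrow>
     \<P>(\<omega> in M. affine_chain (\<lambda>i. \<eta> i \<omega>) m \<ge> u) \<le> C * u powr (- \<theta>)
     \<and> \<P>(\<omega> in M. perpetuity (\<lambda>i. \<eta> i \<omega>) m n \<ge> u) \<le> C * u powr (- \<theta>)"
proof -
  obtain C where C: "C \<ge> 0" and tail: "\<And>n \<eta> u. iid n \<eta> \<Longrightarrow> u > 0 \<Longrightarrow>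
      \<P>(\<omega> in M. perpetuity (\<lambda>i. \<eta> i \<omega>) 0 n \<ge> u) \<le> C * u powr (- \<theta>)"
    using perpetuity_tail by blast
  have "\<P>(\<omega> in M. affine_chain (\<lambda>i. \<eta> i \<omega>) m \<ge> u) \<le> C * u powr (- \<theta>)"
      "\<P>(\<omega> in M. perpetuity (\<lambda>i. \<eta> i \<omega>) m n \<ge> u) \<le> C * u powr (- \<theta>)"
    if h: "iid n \<eta>" "m \<le> n" "u > 0" for n \<eta> m u
  proof -
    have "iid (n - m) (\<lambda>i. \<eta> (m + i))"
      by (rule iid_reindex[OF h(1)]) (use h in \<open>auto simp: inj_on_def\<close>)
    from tail[OF this h(3)] show "\<P>(\<omega> in M. perpetuity (\<lambda>i. \<eta> i \<omega>) m n \<ge> u) \<le> C * u powr (- \<theta>)"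
      by (simp add: perpetuity_shift[OF h(2)])
    show "\<P>(\<omega> in M. affine_chain (\<lambda>i. \<eta> i \<omega>) m \<ge> u) \<le> C * u powr (- \<theta>)"
    proof (cases "m = 0")
      case False
      have "iid (m - 1) (\<lambda>i. \<eta> (m + 1 - i))"
        by (rule iid_reindex[OF h(1)]) (use h False in \<open>auto simp: inj_on_def\<close>)
      from tail[OF this h(3)] show ?thesis using False by (simp add: chain_eq_perpetuity_rev)
    qed (use C h in auto)
  qed
  then show ?thesis using C by blast
qed

section \<open>The double sum for exponents below 1\<close>

text \<open>For \<open>\<theta> < 1\<close> the means of the \<open>W\<^sub>m\<close> are infinite or grow exponentially, and the sum exceeds \<open>u\<close> essentially only if one
summand does: a union bound covers that event, while the truncated mean of each \<open>W\<^sub>m\<close> at level \<open>u\<close> is of order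
\<open>u powr (1 - \<theta>)\<close>, so that Markov's inequality covers the rest.\<close>
lemma chain_sum_tail_heavy:
  assumes "\<theta> < 1"
  shows "\<exists>C\<ge>0. \<forall>n \<eta> u. iid n \<eta> \<and> u > 0 \<longrightarrow>
     \<P>(\<omega> in M. chain_sum (\<lambda>i. \<eta> i \<omega>) n \<ge> u) \<le> C * real n * u powr (- \<theta>)"
proof -
  obtain C where C: "C \<ge> 0" and tail: "\<And>n \<eta> m u. iid n \<eta> \<Longrightarrow> m \<le> n \<Longrightarrow> u > 0 \<Longrightarrow>
      \<P>(\<omega> in M. affine_chain (\<lambda>i. \<eta> i \<omega>) m \<ge> u) \<le> C * u powr (- \<theta>)"
    using chain_and_perpetuity_tail by blast
  define r :: real where "r = 2 powr (\<theta> - 1)"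
  have r: "0 < r" "r < 1" using assms powr_less_mono[of "\<theta> - 1" 0 2] by (auto simp: r_def)
  define D where "D = C * 2 powr \<theta> / (1 - r)"
  have half: "(1 / 2 :: real) ^ k = 2 powr (- real k)" for k
    by (simp add: powr_minus powr_realpow power_one_over inverse_eq_divide)
  have main: "\<P>(\<omega> in M. chain_sum (\<lambda>i. \<eta> i \<omega>) n \<ge> u) \<le> (C + D) * real n * u powr (- \<theta>)"
    if iid: "iid n \<eta>" and u: "u > 0" for n \<eta> u
  proof -
    note [measurable] = iid_measurable[OF iid]
    define W where "W m \<omega> = affine_chain (\<lambda>i. \<eta> i \<omega>) m" for m \<omega>
    define f where "f m \<omega> = (if W m \<omega> < u then W m \<omega> else 0)" for m \<omega>
    have [measurable]: "W m \<in> borel_measurable M" for m unfolding W_def[abs_def] by measurable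
    have [measurable]: "f m \<in> borel_measurable M" for m unfolding f_def[abs_def] by measurable
    have Wpos: "0 \<le> W m \<omega>" for m \<omega> by (simp add: W_def chain_nonneg)
    have int_f: "integrable M (f m)" for m
      by (rule integrable_const_bound[of _ u]) (use Wpos u in \<open>auto simp: f_def\<close>)
    have E_f: "expectation (f m) \<le> D * u powr (1 - \<theta>)" if "m \<le> n" for m
    proof (rule LIMSEQ_le_const)
      show "(\<lambda>J. u * (1 / 2) ^ J + D * u powr (1 - \<theta>)) \<longlonglongrightarrow> D * u powr (1 - \<theta>)"
        using tendsto_add[OF tendsto_mult[OF tendsto_const[of u] LIMSEQ_realpow_zero[of "1/2::real"]] tendsto_const]
        by simp
      have "expectation (f m) \<le> u * (1 / 2) ^ J + D * u powr (1 - \<theta>)" for J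
      proof -
        define G where "G j \<omega> = u * (1 / 2) ^ j * indicator {\<omega>\<in>space M. W m \<omega> \<ge> u * (1 / 2) ^ Suc j} \<omega>" for j \<omega>
        have int_G: "integrable M (G j)" for j
          unfolding G_def[abs_def]
          by (intro integrable_mult_right integrable_real_indicator) (auto simp: emeasure_eq_measure)
        have "expectation (f m) \<le> expectation (\<lambda>\<omega>. u * (1 / 2) ^ J + (\<Sum>j<J. G j \<omega>))"
        proof (rule integral_mono[OF int_f])
          fix \<omega> assume "\<omega> \<in> space M"
          then show "f m \<omega> \<le> u * (1 / 2) ^ J + (\<Sum>j<J. G j \<omega>)"
            using dyadic_truncation_le[OF Wpos[of m \<omega>] u, of J] by (simp add: f_def G_def indicator_def)
        qed (use int_G in auto)
        also have "\<dots> = u * (1 / 2) ^ J + (\<Sum>j<J. expectation (G j))"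
          using int_G by (simp add: prob_space)
        also have "(\<Sum>j<J. expectation (G j)) = (\<Sum>j<J. u * (1 / 2) ^ j * \<P>(\<omega> in M. W m \<omega> \<ge> u * (1 / 2) ^ Suc j))"
          unfolding G_def[abs_def] by simp
        also have "(\<Sum>j<J. u * (1 / 2) ^ j * \<P>(\<omega> in M. W m \<omega> \<ge> u * (1 / 2) ^ Suc j))
            \<le> (\<Sum>j<J. C * 2 powr \<theta> * u powr (1 - \<theta>) * r ^ j)"
        proof (rule sum_mono)
          fix j
          have "\<P>(\<omega> in M. W m \<omega> \<ge> u * (1 / 2) ^ Suc j) \<le> C * (u * (1 / 2) ^ Suc j) powr (- \<theta>)"
            unfolding W_def by (rule tail[OF iid \<open>m \<le> n\<close>]) (use u in simp)
          then have "u * (1 / 2) ^ j * \<P>(\<omega> in M. W m \<omega> \<ge> u * (1 / 2) ^ Suc j)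
              \<le> u * (1 / 2) ^ j * (C * (u * (1 / 2) ^ Suc j) powr (- \<theta>))"
            using u by (intro mult_left_mono) auto
          also have "(u * (1 / 2) ^ Suc j) powr (- \<theta>) = u powr (- \<theta>) * 2 powr (\<theta> * real (Suc j))"
            unfolding half using u by (simp add: powr_mult powr_powr mult.commute del: of_nat_Suc)
          also have "u * (1 / 2) ^ j = u powr 1 * 2 powr (- real j)"
            unfolding half using u by simp
          also have "u powr 1 * 2 powr (- real j) * (C * (u powr (- \<theta>) * 2 powr (\<theta> * real (Suc j))))
              = C * (u powr 1 * u powr (- \<theta>)) * (2 powr (- real j) * 2 powr (\<theta> * real (Suc j)))"
            by simp
          also have "\<dots> = C * u powr (1 - \<theta>) * (2 powr \<theta> * 2 powr ((\<theta> - 1) * real j))"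
          proof -
            have "u powr 1 * u powr (- \<theta>) = u powr (1 - \<theta>)"
              unfolding powr_add[symmetric] by simp
            moreover have "2 powr (- real j) * 2 powr (\<theta> * real (Suc j)) = (2::real) powr \<theta> * 2 powr ((\<theta> - 1) * real j)"
              unfolding powr_add[symmetric] by (simp add: algebra_simps)
            ultimately show ?thesis by simp
          qed
          also have "2 powr ((\<theta> - 1) * real j) = r ^ j"
            using r by (simp add: r_def powr_powr[symmetric] powr_realpow)
          finally show "u * (1 / 2) ^ j * \<P>(\<omega> in M. W m \<omega> \<ge> u * (1 / 2) ^ Suc j) \<le> C * 2 powr \<theta> * u powr (1 - \<theta>) * r ^ j"
            using u by (simp add: half mult_ac)
        qed
        also have "\<dots> = C * 2 powr \<theta> * u powr (1 - \<theta>) * (\<Sum>j<J. r ^ j)" by (simp add: sum_distrib_left)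
        also have "\<dots> \<le> C * 2 powr \<theta> * u powr (1 - \<theta>) * (1 / (1 - r))"
          using C r by (intro mult_left_mono) (auto simp: geometric_sum field_simps)
        also have "\<dots> = D * u powr (1 - \<theta>)" by (simp add: D_def)
        finally show ?thesis by simp
      qed
      then show "\<exists>N. \<forall>J\<ge>N. expectation (f m) \<le> u * (1 / 2) ^ J + D * u powr (1 - \<theta>)" by blast
    qed
    define F where "F \<omega> = (\<Sum>m\<in>{1..n}. f m \<omega>)" for \<omega>
    have int_F: "integrable M F" unfolding F_def[abs_def] by (intro Bochner_Integration.integrable_sum int_f)
    have [measurable]: "F \<in> borel_measurable M" using int_F by simp
    have "{\<omega>\<in>space M. chain_sum (\<lambda>i. \<eta> i \<omega>) n \<ge> u}
        \<subseteq> (\<Union>m\<in>{1..n}. {\<omega>\<in>space M. W m \<omega> \<ge> u}) \<union> {\<omega>\<in>space M. F \<omega> \<ge> u}"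
    proof (intro subsetI, rule ccontr)
      fix \<omega> assume h: "\<omega> \<in> {\<omega>\<in>space M. chain_sum (\<lambda>i. \<eta> i \<omega>) n \<ge> u}"
        and no: "\<omega> \<notin> (\<Union>m\<in>{1..n}. {\<omega>\<in>space M. W m \<omega> \<ge> u}) \<union> {\<omega>\<in>space M. F \<omega> \<ge> u}"
      then have "f m \<omega> = W m \<omega>" if "m \<in> {1..n}" for m
        using that by (force simp: f_def)
      then have "F \<omega> = chain_sum (\<lambda>i. \<eta> i \<omega>) n"
        unfolding F_def chain_sum_def W_def by (intro sum.cong) auto
      then show False using h no by simp
    qed
    then have "\<P>(\<omega> in M. chain_sum (\<lambda>i. \<eta> i \<omega>) n \<ge> u)
        \<le> prob ((\<Union>m\<in>{1..n}. {\<omega>\<in>space M. W m \<omega> \<ge> u}) \<union> {\<omega>\<in>space M. F \<omega> \<ge> u})"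
      by (intro finite_measure_mono) auto
    also have "\<dots> \<le> prob (\<Union>m\<in>{1..n}. {\<omega>\<in>space M. W m \<omega> \<ge> u}) + \<P>(\<omega> in M. F \<omega> \<ge> u)"
      by (intro measure_Un_le) auto
    also have "prob (\<Union>m\<in>{1..n}. {\<omega>\<in>space M. W m \<omega> \<ge> u}) \<le> (\<Sum>m\<in>{1..n}. \<P>(\<omega> in M. W m \<omega> \<ge> u))"
      by (intro finite_measure_subadditive_finite) auto
    also have "\<dots> \<le> (\<Sum>m\<in>{1..n}. C * u powr (- \<theta>))"
      unfolding W_def by (intro sum_mono tail[OF iid _ u]) auto
    also have "\<P>(\<omega> in M. F \<omega> \<ge> u) \<le> expectation F / u"
      using Wpos u by (intro integral_Markov_inequality_measure[OF int_F, of "{}"]) (auto simp: F_def f_def intro!: sum_nonneg)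
    also have "expectation F = (\<Sum>m\<in>{1..n}. expectation (f m))" unfolding F_def by (simp add: int_f)
    also have "\<dots> / u \<le> (\<Sum>m\<in>{1..n}. D * u powr (1 - \<theta>)) / u"
      using u by (intro divide_right_mono sum_mono E_f) auto
    also have "(\<Sum>m\<in>{1..n}. C * u powr (- \<theta>)) + (\<Sum>m\<in>{1..n}. D * u powr (1 - \<theta>)) / u = (C + D) * real n * u powr (- \<theta>)"
      using u by (simp add: powr_diff powr_minus field_simps)
    finally show ?thesis by simp
  qed
  have "D \<ge> 0" using C r by (simp add: D_def)
  then show ?thesis using main C by (intro exI[of _ "C + D"]) auto
qed

section \<open>The double sum for exponents above 1\<close>

text \<open>As long as the recursion stays below \<open>c / l\<close>, the process \<open>exp (l U\<^sub>m + l k W\<^sub>m - l K m)\<close> with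
\<open>U\<^sub>m = W\<^sub>1 + \<dots> + W\<^sub>m\<close> is a supermartingale. The multiple \<open>k\<close> of the current value pays in advance for its future
contributions, which shrink on average by the factor \<open>\<rho> = mgf 1 < 1\<close> per step. Below the truncation level
the exponential is linear up to a factor \<open>1 + d\<close>, so that only the first moment of \<open>exp \<xi>\<close> enters, and \<open>d\<close> is
chosen so small that \<open>(1 + d) \<rho> < 1\<close>.\<close>
lemma truncated_exponential_moment:
  assumes "\<theta> > 1"
  shows "\<exists>c K. c > 0 \<and> K \<ge> 0 \<and> (\<forall>n \<eta> l u. iid n \<eta> \<and> l > 0 \<longrightarrow>
     \<P>(\<omega> in M. chain_sum (\<lambda>i. \<eta> i \<omega>) n \<ge> u \<and> (\<forall>j\<le>n. affine_chain (\<lambda>i. \<eta> i \<omega>) j \<le> c / l))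
       \<le> exp (l * K * real n - l * u))"
proof -
  define \<rho> where "\<rho> = mgf 1"
  have rho: "0 \<le> \<rho>" "\<rho> < 1"
    using mgf_nonneg mgf_less_1[of 1] assms by (auto simp: \<rho>_def)
  define d where "d = (1 - \<rho>) / 2"
  have d: "0 < d" "d \<le> 1" using rho by (auto simp: d_def)
  define r where "r = (1 + d) * \<rho>"
  have "r = \<rho> + \<rho> * ((1 - \<rho>) / 2)" by (simp add: r_def d_def algebra_simps)
  also have "\<dots> \<le> \<rho> + 1 * ((1 - \<rho>) / 2)" using rho by (intro add_left_mono mult_right_mono) auto
  also have "\<dots> < 1" using rho by argo
  finally have r: "r < 1" "0 \<le> r" using rho d by (auto simp: r_def)
  \<comment> \<open>The fixed point that balances the gain and the loss of one step: \<open>(1 + d) (1 + k) \<rho> = k\<close>.\<close>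
  define k where "k = r / (1 - r)"
  have k: "0 \<le> k" "(1 + k) * r = k" using r by (auto simp: k_def field_simps)
  define K where "K = (1 + d) * (1 + k)"
  define c where "c = d / (1 + k)"
  have c: "c > 0" using d k by (simp add: c_def)
  have K: "K \<ge> 0" using d k by (simp add: K_def)
  have K_rho: "K * \<rho> = k" using k(2) by (simp add: K_def r_def algebra_simps)
  have exp_le: "exp t \<le> 1 + (1 + d) * t" if "0 \<le> t" "t \<le> d" for t
  proof -
    have "exp t \<le> 1 + t + t\<^sup>2" using that d by (intro exp_bound) auto
    also have "t\<^sup>2 \<le> d * t" using that by (simp add: power2_eq_square mult_right_mono)
    finally show ?thesis by (simp add: algebra_simps)
  qed
  have main: "\<P>(\<omega> in M. chain_sum (\<lambda>i. \<eta> i \<omega>) n \<ge> u \<and> (\<forall>j\<le>n. affine_chain (\<lambda>i. \<eta> i \<omega>) j \<le> c / l))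
       \<le> exp (l * K * real n - l * u)"
    if iid: "iid n \<eta>" and l: "l > 0" for n \<eta> l u
  proof -
    note [measurable] = iid_measurable[OF iid]
    let ?X = "\<lambda>\<omega> i. \<eta> i \<omega>"
    define z where "z m x = (if \<forall>j\<le>m. affine_chain x j \<le> c / l then exp (l * chain_sum x m) else 0)" for m x
    define V where "V m x = z m x * exp (l * k * affine_chain x m)" for m x
    have zm [measurable]: "z m \<in> borel_measurable seqM" for m unfolding z_def[abs_def] by measurable
    have Vm [measurable]: "V m \<in> borel_measurable seqM" for m unfolding V_def[abs_def] by measurable
    have z_0: "z m x = 0" if "\<not> (\<forall>j\<le>m. affine_chain x j \<le> c / l)" for m x
      unfolding z_def using that by (rule if_not_P)
    have z_nonneg: "0 \<le> z m x" for m x by (simp add: z_def)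
    have z_le: "z m x \<le> exp (real m * c)" for m x
    proof (cases "\<forall>j\<le>m. affine_chain x j \<le> c / l")
      case True
      have "chain_sum x m \<le> real (card {1..m}) * (c / l)"
        unfolding chain_sum_def using True by (intro sum_bounded_above) auto
      then have "l * chain_sum x m \<le> l * (real m * (c / l))" using l by (intro mult_left_mono) auto
      also have "\<dots> = real m * c" using l by simp
      finally show ?thesis using True by (simp add: z_def)
    qed (simp add: z_0)
    have zW_le: "z m x * affine_chain x m \<le> exp (real m * c) * (c / l)" for m x
    proof (cases "\<forall>j\<le>m. affine_chain x j \<le> c / l")
      case True
      then show ?thesis using z_le[of m x] z_nonneg[of m x] c l by (intro mult_mono) (auto simp: chain_nonneg)
    qed (use c l in \<open>simp add: z_0\<close>)
    have int_z: "integrable M (\<lambda>\<omega>. z m (?X \<omega>))" for m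
      by (rule integrable_const_bound[of _ "exp (real m * c)"]) (use z_nonneg z_le in auto)
    have int_zW: "integrable M (\<lambda>\<omega>. z m (?X \<omega>) * affine_chain (?X \<omega>) m)" for m
      by (rule integrable_const_bound[of _ "exp (real m * c) * (c / l)"])
         (use z_nonneg zW_le chain_nonneg in auto)
    have int_V: "integrable M (\<lambda>\<omega>. V m (?X \<omega>))" for m
    proof (rule integrable_const_bound[of _ "exp (real m * c) * exp (l * k * (c / l))"])
      have "V m x \<le> exp (real m * c) * exp (l * k * (c / l))" for x
      proof (cases "\<forall>j\<le>m. affine_chain x j \<le> c / l")
        case True
        then have "exp (l * k * affine_chain x m) \<le> exp (l * k * (c / l))"
          using l k by (simp only: exp_le_cancel_iff) (intro mult_left_mono; simp)
        then show ?thesis unfolding V_def using z_le[of m x] z_nonneg[of m x] by (intro mult_mono) auto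
      qed (simp add: V_def z_0)
      then show "AE \<omega> in M. norm (V m (?X \<omega>)) \<le> exp (real m * c) * exp (l * k * (c / l))"
        using z_nonneg by (simp add: V_def)
    qed measurable
    have E_V: "expectation (\<lambda>\<omega>. V m (?X \<omega>)) \<le> exp (l * K * real m)" if "m \<le> n" for m
      using that
    proof (induction m)
      case 0
      then show ?case using c l by (simp add: V_def z_def prob_space)
    next
      case (Suc m)
      let ?A = "\<lambda>\<omega>. exp (\<eta> (Suc m) \<omega>)"
      have Sm: "Suc m \<in> {1..n}" using Suc.prems by simp
      have int_A: "integrable M ?A" and E_A: "expectation ?A = \<rho>"
        using iid_single[OF iid Sm, of 1] assms by (simp_all add: \<rho>_def)
      have ind: "indep_var borel (\<lambda>\<omega>. z m (?X \<omega>) * affine_chain (?X \<omega>) m) borel ?A"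
      proof (rule indep_var_blocks[where A = "{1..m}" and B = "{Suc m}" and F = "\<lambda>x. z m x * affine_chain x m" and G = "\<lambda>x. exp (x (Suc m))"])
        show "indep_vars (\<lambda>_. borel) \<eta> {1..n}" using iid by (simp add: iid_def)
        show "(\<lambda>x. z m x * affine_chain x m) \<in> borel_measurable seqM" by measurable
        show "(\<lambda>x::nat \<Rightarrow> real. exp (x (Suc m))) \<in> borel_measurable seqM" by measurable
        show "z m x * affine_chain x m = z m y * affine_chain y m" if "\<And>i. i \<in> {1..m} \<Longrightarrow> x i = y i" for x y
        proof -
          have "affine_chain x j = affine_chain y j" if "j \<le> m" for j
            by (rule chain_cong, rule \<open>\<And>i. i \<in> {1..m} \<Longrightarrow> x i = y i\<close>) (use that in auto)
          moreover have "chain_sum x m = chain_sum y m"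
            by (rule chain_sum_cong, rule \<open>\<And>i. i \<in> {1..m} \<Longrightarrow> x i = y i\<close>) auto
          moreover from calculation have "(\<forall>j\<le>m. affine_chain x j \<le> c / l) \<longleftrightarrow> (\<forall>j\<le>m. affine_chain y j \<le> c / l)"
            "affine_chain x m = affine_chain y m" by auto
          ultimately show ?thesis by (simp only: z_def)
        qed
      qed (use Suc.prems in auto)
      note int_zWA = indep_var_integrable[OF ind int_zW int_A]
      note E_zWA = indep_var_lebesgue_integral[OF ind int_zW int_A]
      have step: "V (Suc m) x \<le> z m x * (1 + l * K) + l * K * (z m x * affine_chain x m * exp (x (Suc m)))" for x
      proof (cases "\<forall>j\<le>Suc m. affine_chain x j \<le> c / l")
        case True
        then have G: "\<forall>j\<le>m. affine_chain x j \<le> c / l" by auto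
        define t where "t = l * (1 + k) * affine_chain x (Suc m)"
        have "t \<le> l * (1 + k) * (c / l)"
          unfolding t_def using True l k by (intro mult_left_mono) auto
        also have "\<dots> = d" using l k by (simp add: c_def)
        finally have "exp t \<le> 1 + (1 + d) * t"
          using l k chain_nonneg[of x "Suc m"] by (intro exp_le) (auto simp: t_def)
        also have "(1 + d) * t = l * K * (1 + exp (x (Suc m)) * affine_chain x m)"
          by (simp add: t_def K_def chain_Suc algebra_simps)
        finally have "z m x * exp t \<le> z m x * (1 + l * K * (1 + exp (x (Suc m)) * affine_chain x m))"
          using z_nonneg by (intro mult_left_mono)
        moreover have "V (Suc m) x = z m x * exp t"
          using True G by (simp add: V_def z_def t_def chain_sum_Suc exp_add[symmetric] algebra_simps)
        ultimately show ?thesis by (simp add: algebra_simps)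
      next
        case False
        then have "V (Suc m) x = 0" by (simp add: V_def z_0)
        then show ?thesis using z_nonneg[of m x] chain_nonneg[of x m] K l by simp
      qed
      have "expectation (\<lambda>\<omega>. V (Suc m) (?X \<omega>))
          \<le> expectation (\<lambda>\<omega>. z m (?X \<omega>) * (1 + l * K) + l * K * (z m (?X \<omega>) * affine_chain (?X \<omega>) m * ?A \<omega>))"
        by (rule integral_mono[OF int_V _ step]) (use int_z int_zWA in auto)
      also have "\<dots> = expectation (\<lambda>\<omega>. z m (?X \<omega>)) * (1 + l * K)
          + l * K * (expectation (\<lambda>\<omega>. z m (?X \<omega>) * affine_chain (?X \<omega>) m) * \<rho>)"
        using int_z int_zWA by (simp add: E_zWA E_A)
      also have "\<dots> = expectation (\<lambda>\<omega>. z m (?X \<omega>) * (1 + l * K) + l * k * (z m (?X \<omega>) * affine_chain (?X \<omega>) m))"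
      proof -
        have "l * K * (e * \<rho>) = l * k * e" for e unfolding K_rho[symmetric] by simp
        then show ?thesis using int_z int_zW by simp
      qed
      also have "\<dots> \<le> expectation (\<lambda>\<omega>. exp (l * K) * V m (?X \<omega>))"
      proof (rule integral_mono)
        fix \<omega>
        let ?w = "affine_chain (?X \<omega>) m"
        have "z m (?X \<omega>) * (1 + l * K) + l * k * (z m (?X \<omega>) * ?w) = z m (?X \<omega>) * (1 + (l * K + l * k * ?w))"
          by (simp add: algebra_simps)
        also have "\<dots> \<le> z m (?X \<omega>) * exp (l * K + l * k * ?w)"
          using z_nonneg by (intro mult_left_mono exp_ge_add_one_self)
        also have "\<dots> = exp (l * K) * V m (?X \<omega>)" by (simp add: V_def exp_add)
        finally show "z m (?X \<omega>) * (1 + l * K) + l * k * (z m (?X \<omega>) * ?w) \<le> exp (l * K) * V m (?X \<omega>)" .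
      qed (use int_z int_zW int_V in auto)
      also have "\<dots> = exp (l * K) * expectation (\<lambda>\<omega>. V m (?X \<omega>))" by simp
      also have "\<dots> \<le> exp (l * K) * exp (l * K * real m)" using Suc by simp
      also have "\<dots> = exp (l * K * real (Suc m))" by (simp add: exp_add[symmetric] algebra_simps)
      finally show ?case .
    qed
    have "\<P>(\<omega> in M. chain_sum (?X \<omega>) n \<ge> u \<and> (\<forall>j\<le>n. affine_chain (?X \<omega>) j \<le> c / l))
        \<le> \<P>(\<omega> in M. V n (?X \<omega>) \<ge> exp (l * u))"
    proof (intro finite_measure_mono)
      have "exp (l * u) \<le> V n x" if "chain_sum x n \<ge> u" "\<forall>j\<le>n. affine_chain x j \<le> c / l" for x
      proof -
        have "exp (l * u) * 1 \<le> exp (l * chain_sum x n) * exp (l * k * affine_chain x n)"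
          using that l k chain_nonneg[of x n] by (intro mult_mono) auto
        then show ?thesis using that by (simp add: V_def z_def)
      qed
      then show "{\<omega> \<in> space M. chain_sum (?X \<omega>) n \<ge> u \<and> (\<forall>j\<le>n. affine_chain (?X \<omega>) j \<le> c / l)}
          \<subseteq> {\<omega> \<in> space M. V n (?X \<omega>) \<ge> exp (l * u)}" by auto
    qed measurable
    also have "\<dots> \<le> expectation (\<lambda>\<omega>. V n (?X \<omega>)) / exp (l * u)"
      by (rule integral_Markov_inequality_measure[OF int_V, of "{}"]) (auto simp: V_def z_nonneg)
    also have "\<dots> \<le> exp (l * K * real n) / exp (l * u)" by (intro divide_right_mono E_V) auto
    finally show ?thesis by (simp add: exp_diff)
  qed
  show ?thesis using c K main by blast
qed
end

definition chain_sum_after :: "(nat \<Rightarrow> real) \<Rightarrow> nat \<Rightarrow> nat \<Rightarrow> real" where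
  "chain_sum_after x m n = (\<Sum>j\<in>{m<..n}. \<Sum>k\<in>{m<..j}. exp (walk x k j))"

lemma chain_sum_after_measurable [measurable]: "(\<lambda>x. chain_sum_after x m n) \<in> borel_measurable seqM"
  unfolding chain_sum_after_def by measurable

lemma chain_sum_after_cong:
  "(\<And>i. m < i \<Longrightarrow> i \<le> n \<Longrightarrow> x i = y i) \<Longrightarrow> chain_sum_after x m n = chain_sum_after y m n"
  unfolding chain_sum_after_def by (intro sum.cong arg_cong[where f = exp] walk_cong) auto

lemma chain_sum_after_le: "chain_sum_after x m n \<le> chain_sum x n"
proof -
  have "chain_sum_after x m n \<le> (\<Sum>j\<in>{m<..n}. affine_chain x j)"
    unfolding chain_sum_after_def affine_chain_def by (intro sum_mono sum_mono2) auto
  also have "\<dots> \<le> chain_sum x n"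
    unfolding chain_sum_def by (intro sum_mono2) (auto simp: chain_nonneg)
  finally show ?thesis .
qed

lemma perpetuity_pos: "k \<le> n \<Longrightarrow> 0 < perpetuity x k n"
  unfolding perpetuity_def by (intro sum_pos) auto

text \<open>Splitting the pairs of indices at \<open>m\<close>: both before, both after, or straddling \<open>m\<close>. The straddling pairs
factor into a past part and a future part; the bound is not an equality because the perpetuity
also contains the term 1 that belongs to \<open>W\<^sub>m\<close> itself.\<close>
lemma chain_sum_split:
  assumes "m \<le> n"
  shows "chain_sum x n \<le> chain_sum x m + affine_chain x m * perpetuity x m n + chain_sum_after x m n"
proof -
  have "affine_chain x j = affine_chain x m * exp (walk x m j) + (\<Sum>k\<in>{m<..j}. exp (walk x k j))" if "m < j" for j
  proof -
    have "{1..j} = {1..m} \<union> {m<..j}" using that by auto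
    then have "affine_chain x j = (\<Sum>k\<in>{1..m}. exp (walk x k j)) + (\<Sum>k\<in>{m<..j}. exp (walk x k j))"
      unfolding affine_chain_def by (simp only:) (rule sum.union_disjoint; auto)
    also have "(\<Sum>k\<in>{1..m}. exp (walk x k j)) = affine_chain x m * exp (walk x m j)"
      unfolding affine_chain_def sum_distrib_right using that
      by (intro sum.cong) (auto simp: exp_add[symmetric] walk_append)
    finally show ?thesis .
  qed
  then have "(\<Sum>j\<in>{m<..n}. affine_chain x j) = affine_chain x m * (\<Sum>j\<in>{m<..n}. exp (walk x m j)) + chain_sum_after x m n"
    by (simp add: chain_sum_after_def sum.distrib sum_distrib_left)
  moreover have "(\<Sum>j\<in>{m<..n}. exp (walk x m j)) \<le> perpetuity x m n"
    unfolding perpetuity_def by (intro sum_mono2) auto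
  then have "affine_chain x m * (\<Sum>j\<in>{m<..n}. exp (walk x m j)) \<le> affine_chain x m * perpetuity x m n"
    by (intro mult_left_mono chain_nonneg)
  moreover have "{1..n} = {1..m} \<union> {m<..n}" using assms by auto
  then have "chain_sum x n = chain_sum x m + (\<Sum>j\<in>{m<..n}. affine_chain x j)"
    unfolding chain_sum_def by (simp only:) (rule sum.union_disjoint; auto)
  ultimately show ?thesis by linarith
qed

definition passes :: "real \<Rightarrow> nat \<Rightarrow> (nat \<Rightarrow> real) \<Rightarrow> bool" where
  "passes v m x \<longleftrightarrow> chain_sum x m \<ge> v \<and> (\<forall>j<m. chain_sum x j < v)"

lemma passes_measurable [measurable]: "Measurable.pred seqM (passes v m)"
  unfolding passes_def by measurable

lemma passes_unique: "passes v m x \<Longrightarrow> passes v l x \<Longrightarrow> m = l"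
  unfolding passes_def by (meson linorder_neqE_nat not_le)

lemma passes_le: "passes v m x \<Longrightarrow> m \<le> n \<Longrightarrow> v \<le> chain_sum x n"
  unfolding passes_def using chain_sum_mono[of m n x] by linarith

lemma passes_cong: "(\<And>i. 0 < i \<Longrightarrow> i \<le> m \<Longrightarrow> x i = y i) \<Longrightarrow> passes v m x = passes v m y"
proof -
  assume h: "\<And>i. 0 < i \<Longrightarrow> i \<le> m \<Longrightarrow> x i = y i"
  have "chain_sum x j = chain_sum y j" if "j \<le> m" for j
    by (rule chain_sum_cong) (use h that in auto)
  then show ?thesis by (simp add: passes_def)
qed

text \<open>Stop when the partial sums first reach \<open>u / 3\<close>. Unless a single value of the recursion is of order \<open>u\<close>, the stopped sum
is below \<open>u / 2\<close>, so the remaining half must come from the pairs after \<open>m\<close> or from the straddling pairs, whose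
contribution is a product of independent factors. The size of the past factor is bracketed dyadically,
and the future factor must compensate it.\<close>
lemma chain_sum_large_cases:
  assumes u: "u > 0" and large: "chain_sum x n \<ge> u"
  shows "\<exists>m\<in>{1..n}. affine_chain x m \<ge> u / 6
     \<or> passes (u / 3) m x \<and> chain_sum_after x m n \<ge> u / 3
     \<or> passes (u / 3) m x \<and> perpetuity x m n \<ge> 2 ^ J
     \<or> (\<exists>i<J. affine_chain x m \<ge> u / 12 * (1 / 2) ^ i \<and> perpetuity x m n \<ge> 2 ^ i)"
proof (cases "\<exists>m\<in>{1..n}. affine_chain x m \<ge> u / 6")
  case False
  define m where "m = (LEAST m. chain_sum x m \<ge> u / 3)"
  have m: "chain_sum x m \<ge> u / 3" "m \<le> n" unfolding m_def
    using large u by (auto intro: LeastI[of _ n] Least_le)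
  have below: "chain_sum x j < u / 3" if "j < m" for j
    using not_less_Least[of j "\<lambda>m. chain_sum x m \<ge> u / 3"] that unfolding m_def by simp
  then have p: "passes (u / 3) m x" using m by (simp add: passes_def)
  have "m \<noteq> 0" using m u by (cases m) auto
  then obtain l where l: "m = Suc l" by (cases m) auto
  have m_in: "m \<in> {1..n}" using m l by simp
  then have W: "affine_chain x m < u / 6" using False by (meson not_le)
  then have "chain_sum x m < u / 3 + u / 6"
    using below[of l] by (simp add: l chain_sum_Suc)
  then consider "chain_sum_after x m n \<ge> u / 3" | "affine_chain x m * perpetuity x m n \<ge> u / 6"
    using chain_sum_split[OF m(2), of x] large by fastforce
  then show ?thesis
  proof cases
    case 2
    have R: "perpetuity x m n \<ge> 2 ^ i" if "affine_chain x m < u / 6 * (1 / 2) ^ i" for i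
    proof -
      have "affine_chain x m * perpetuity x m n \<le> u / 6 * (1 / 2) ^ i * perpetuity x m n"
        using that perpetuity_pos[OF m(2), of x] by (intro mult_right_mono) auto
      then have "u / 6 * 1 \<le> u / 6 * ((1 / 2) ^ i * perpetuity x m n)" using 2 by (simp add: mult_ac)
      then have "1 \<le> (1 / 2) ^ i * perpetuity x m n" using u by (subst (asm) mult_le_cancel_left_pos) auto
      then show ?thesis by (simp add: power_one_over field_simps)
    qed
    from dyadic_bracket[OF W, of J] consider "affine_chain x m < u / 6 * (1 / 2) ^ J"
      | i where "i < J" "u / 6 * (1 / 2) ^ Suc i \<le> affine_chain x m" "affine_chain x m < u / 6 * (1 / 2) ^ i"
      by blast
    then show ?thesis
    proof cases
      case 1
      then show ?thesis using R p m_in by blast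
    next
      case (2 i)
      then have "affine_chain x m \<ge> u / 12 * (1 / 2) ^ i" by simp
      then show ?thesis using R[of i] 2 m_in by blast
    qed
  qed (use p m_in in blast)
qed blast

context cramer_walk begin

text \<open>An argument of Hoffmann-Joergensen type for \<open>u \<ge> n\<^sup>3\<close>. Let \<open>p\<close> be the probability that the sum reaches \<open>u / 3\<close>;
a crude union bound gives \<open>p\<close> of order \<open>n powr (1 + \<theta>) * u powr (- \<theta>)\<close>. Passing \<open>u / 3\<close> once more after stopping
has probability at most \<open>p\<^sup>2\<close>, which is negligible because \<open>u\<close> is large compared with \<open>n\<close>. For the
straddling pairs each dyadic scale costs \<open>n * u powr (- \<theta>)\<close>; only the first \<open>log\<^sub>2 n\<close> scales are treated
separately, and from there on the event that the sum passes \<open>u / 3\<close> at all is used once. This is where the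
logarithm, in \<open>n\<close> and not in \<open>u\<close>, comes from.\<close>
lemma chain_sum_tail_far:
  assumes theta1: "\<theta> > 1"
  shows "\<exists>C\<ge>0. \<forall>n \<eta> u. iid n \<eta> \<and> n \<ge> 2 \<and> u \<ge> real n ^ 3 \<longrightarrow>
     \<P>(\<omega> in M. chain_sum (\<lambda>i. \<eta> i \<omega>) n \<ge> u) \<le> C * (real n * ln (real n)) * u powr (- \<theta>)"
proof -
  obtain C where C: "C \<ge> 0" and
    tailW: "\<And>n \<eta> m u. iid n \<eta> \<Longrightarrow> m \<le> n \<Longrightarrow> u > 0 \<Longrightarrow>
      \<P>(\<omega> in M. affine_chain (\<lambda>i. \<eta> i \<omega>) m \<ge> u) \<le> C * u powr (- \<theta>)" and
    tailR: "\<And>n \<eta> m u. iid n \<eta> \<Longrightarrow> m \<le> n \<Longrightarrow> u > 0 \<Longrightarrow>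
      \<P>(\<omega> in M. perpetuity (\<lambda>i. \<eta> i \<omega>) m n \<ge> u) \<le> C * u powr (- \<theta>)"
    using chain_and_perpetuity_tail by blast
  define D where "D = C * 6 powr \<theta> + C\<^sup>2 * 9 powr \<theta> + C\<^sup>2 * 3 powr \<theta>"
  define E where "E = C\<^sup>2 * 12 powr \<theta>"
  have DE: "D \<ge> 0" "E \<ge> 0" using C by (auto simp: D_def E_def)
  have main: "\<P>(\<omega> in M. chain_sum (\<lambda>i. \<eta> i \<omega>) n \<ge> u) \<le> (D / ln 2 + E * (2 / ln 2)) * (real n * ln (real n)) * u powr (- \<theta>)"
    if iid: "iid n \<eta>" and n: "n \<ge> 2" and u: "u \<ge> real n ^ 3" for n \<eta> u
  proof -
    note [measurable] = iid_measurable[OF iid]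
    let ?X = "\<lambda>\<omega> i. \<eta> i \<omega>"
    let ?U = "u powr (- \<theta>)"
    have npos: "real n > 0" using n by simp
    have upos: "u > 0" using u npos by (meson less_le_trans zero_less_power)
    have ind: "indep_vars (\<lambda>_. borel) \<eta> {1..n}" using iid by (simp add: iid_def)
    obtain J :: nat where J: "real n \<le> 2 ^ J" "real J \<le> 2 / ln 2 * ln (real n)"
    proof
      define J where "J = nat \<lceil>log 2 (real n)\<rceil>"
      have log1: "1 \<le> log 2 (real n)" using n by simp
      then have "real J = real_of_int \<lceil>log 2 (real n)\<rceil>" by (simp add: J_def)
      then have J': "log 2 (real n) \<le> real J" "real J \<le> log 2 (real n) + 1" by linarith+
      have "real n = 2 powr log 2 (real n)" using npos by simp
      also have "\<dots> \<le> 2 powr real J" using J' by (intro powr_mono) auto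
      finally show "real n \<le> 2 ^ J" by (simp add: powr_realpow)
      have "real J \<le> 2 * log 2 (real n)" using J' log1 by linarith
      then show "real J \<le> 2 / ln 2 * ln (real n)" by (simp add: log_def)
    qed
    define p where "p = \<P>(\<omega> in M. chain_sum (?X \<omega>) n \<ge> u / 3)"
    have p_nonneg: "0 \<le> p" by (simp add: p_def)
    have p_le: "p \<le> C * 3 powr \<theta> * real n powr (1 + \<theta>) * ?U"
    proof -
      have "{\<omega>\<in>space M. chain_sum (?X \<omega>) n \<ge> u / 3} \<subseteq> (\<Union>m\<in>{1..n}. {\<omega>\<in>space M. affine_chain (?X \<omega>) m \<ge> u / (3 * real n)})"
      proof (intro subsetI, rule ccontr)
        fix \<omega> assume h: "\<omega> \<in> {\<omega>\<in>space M. chain_sum (?X \<omega>) n \<ge> u / 3}"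
          and no: "\<omega> \<notin> (\<Union>m\<in>{1..n}. {\<omega>\<in>space M. affine_chain (?X \<omega>) m \<ge> u / (3 * real n)})"
        have "affine_chain (?X \<omega>) m < u / (3 * real n)" if "m \<in> {1..n}" for m
          using h no that by (simp add: not_le)
        then have "chain_sum (?X \<omega>) n < (\<Sum>m\<in>{1..n}. u / (3 * real n))"
          unfolding chain_sum_def using n by (intro sum_strict_mono) simp_all
        also have "\<dots> = u / 3" using n by simp
        finally show False using h by simp
      qed
      then have "p \<le> prob (\<Union>m\<in>{1..n}. {\<omega>\<in>space M. affine_chain (?X \<omega>) m \<ge> u / (3 * real n)})"
        unfolding p_def by (intro finite_measure_mono) auto
      also have "\<dots> \<le> (\<Sum>m\<in>{1..n}. \<P>(\<omega> in M. affine_chain (?X \<omega>) m \<ge> u / (3 * real n)))"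
        by (intro finite_measure_subadditive_finite) auto
      also have "\<dots> \<le> (\<Sum>m\<in>{1..n}. C * (u / (3 * real n)) powr (- \<theta>))"
        using upos npos by (intro sum_mono tailW[OF iid]) auto
      also have "\<dots> = C * 3 powr \<theta> * real n powr (1 + \<theta>) * ?U"
        using upos npos by (simp add: powr_divide powr_mult powr_minus powr_add field_simps)
      finally show ?thesis .
    qed
    have sum_passes: "(\<Sum>m\<in>{1..n}. \<P>(\<omega> in M. passes (u / 3) m (?X \<omega>))) \<le> p"
    proof -
      have "(\<Sum>m\<in>{1..n}. \<P>(\<omega> in M. passes (u / 3) m (?X \<omega>))) = prob (\<Union>m\<in>{1..n}. {\<omega>\<in>space M. passes (u / 3) m (?X \<omega>)})"
      proof (rule finite_measure_finite_Union[symmetric])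
        show "disjoint_family_on (\<lambda>m. {\<omega>\<in>space M. passes (u / 3) m (?X \<omega>)}) {1..n}"
          unfolding disjoint_family_on_def using passes_unique by blast
      qed auto
      also have "\<dots> \<le> p" unfolding p_def
      proof (intro finite_measure_mono)
        show "(\<Union>m\<in>{1..n}. {\<omega>\<in>space M. passes (u / 3) m (?X \<omega>)}) \<subseteq> {\<omega>\<in>space M. chain_sum (?X \<omega>) n \<ge> u / 3}"
          by safe (erule passes_le; simp)
      qed measurable
      finally show ?thesis .
    qed
    define A1 where "A1 m = {\<omega>\<in>space M. affine_chain (?X \<omega>) m \<ge> u / 6}" for m
    define A2 where "A2 m = {\<omega>\<in>space M. passes (u / 3) m (?X \<omega>) \<and> chain_sum_after (?X \<omega>) m n \<ge> u / 3}" for m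
    define A3 where "A3 m = {\<omega>\<in>space M. passes (u / 3) m (?X \<omega>) \<and> perpetuity (?X \<omega>) m n \<ge> 2 ^ J}" for m
    define A4 where "A4 m i = {\<omega>\<in>space M. affine_chain (?X \<omega>) m \<ge> u / 12 * (1 / 2) ^ i \<and> perpetuity (?X \<omega>) m n \<ge> 2 ^ i}" for m i
    have [measurable]: "A1 m \<in> events" "A2 m \<in> events" "A3 m \<in> events" "A4 m i \<in> events" for m i
      unfolding A1_def A2_def A3_def A4_def by measurable
    have A1: "prob (A1 m) \<le> C * 6 powr \<theta> * ?U" if "m \<in> {1..n}" for m
    proof -
      have "prob (A1 m) \<le> C * (u / 6) powr (- \<theta>)"
        unfolding A1_def using that upos by (intro tailW[OF iid]) auto
      then show ?thesis using upos by (simp add: powr_divide powr_minus field_simps)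
    qed
    have A2: "prob (A2 m) \<le> \<P>(\<omega> in M. passes (u / 3) m (?X \<omega>)) * p" if m: "m \<in> {1..n}" for m
    proof -
      have "prob (A2 m) = \<P>(\<omega> in M. passes (u / 3) m (?X \<omega>)) * \<P>(\<omega> in M. chain_sum_after (?X \<omega>) m n \<ge> u / 3)"
        unfolding A2_def
      proof (rule prob_blocks[OF ind, where A = "{1..m}" and B = "{m<..n}"])
        show "passes (u / 3) m x = passes (u / 3) m y" if "\<And>i. i \<in> {1..m} \<Longrightarrow> x i = y i" for x y
          by (rule passes_cong, rule that) auto
        show "(u / 3 \<le> chain_sum_after x m n) = (u / 3 \<le> chain_sum_after y m n)" if "\<And>i. i \<in> {m<..n} \<Longrightarrow> x i = y i" for x y
          by (rule arg_cong[where f = "\<lambda>w. u / 3 \<le> w"], rule chain_sum_after_cong, rule that) auto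
      qed (use m in auto)
      also have "\<dots> \<le> \<P>(\<omega> in M. passes (u / 3) m (?X \<omega>)) * p"
        unfolding p_def
      proof (intro mult_left_mono finite_measure_mono)
        show "{\<omega>\<in>space M. chain_sum_after (?X \<omega>) m n \<ge> u / 3} \<subseteq> {\<omega>\<in>space M. chain_sum (?X \<omega>) n \<ge> u / 3}"
          using order_trans[OF _ chain_sum_after_le] by blast
      qed auto
      finally show ?thesis .
    qed
    have A3: "prob (A3 m) \<le> \<P>(\<omega> in M. passes (u / 3) m (?X \<omega>)) * (C * real n powr (- \<theta>))" if m: "m \<in> {1..n}" for m
    proof -
      have "prob (A3 m) = \<P>(\<omega> in M. passes (u / 3) m (?X \<omega>)) * \<P>(\<omega> in M. perpetuity (?X \<omega>) m n \<ge> 2 ^ J)"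
        unfolding A3_def
      proof (rule prob_blocks[OF ind, where A = "{1..m}" and B = "{m<..n}"])
        show "passes (u / 3) m x = passes (u / 3) m y" if "\<And>i. i \<in> {1..m} \<Longrightarrow> x i = y i" for x y
          by (rule passes_cong, rule that) auto
        show "(2 ^ J \<le> perpetuity x m n) = (2 ^ J \<le> perpetuity y m n)" if "\<And>i. i \<in> {m<..n} \<Longrightarrow> x i = y i" for x y
          by (rule arg_cong[where f = "\<lambda>w. 2 ^ J \<le> w"], rule perpetuity_cong, rule that) auto
      qed (use m in auto)
      also have "\<P>(\<omega> in M. perpetuity (?X \<omega>) m n \<ge> 2 ^ J) \<le> C * (2 ^ J) powr (- \<theta>)"
        using m by (intro tailR[OF iid]) auto
      also have "(2 ^ J) powr (- \<theta>) \<le> real n powr (- \<theta>)"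
        using J npos theta_pos by (intro powr_mono2') auto
      finally show ?thesis using C by (simp add: mult_left_mono)
    qed
    have A4: "prob (A4 m i) \<le> E * ?U" if m: "m \<in> {1..n}" for m i
    proof -
      have "prob (A4 m i) = \<P>(\<omega> in M. affine_chain (?X \<omega>) m \<ge> u / 12 * (1 / 2) ^ i) * \<P>(\<omega> in M. perpetuity (?X \<omega>) m n \<ge> 2 ^ i)"
        unfolding A4_def
      proof (rule prob_blocks[OF ind, where A = "{1..m}" and B = "{m<..n}"])
        show "(u / 12 * (1 / 2) ^ i \<le> affine_chain x m) = (u / 12 * (1 / 2) ^ i \<le> affine_chain y m)" if "\<And>i. i \<in> {1..m} \<Longrightarrow> x i = y i" for x y
          by (rule arg_cong[where f = "\<lambda>w. u / 12 * (1 / 2) ^ i \<le> w"], rule chain_cong, rule that) auto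
        show "(2 ^ i \<le> perpetuity x m n) = (2 ^ i \<le> perpetuity y m n)" if "\<And>i. i \<in> {m<..n} \<Longrightarrow> x i = y i" for x y
          by (rule arg_cong[where f = "\<lambda>w. 2 ^ i \<le> w"], rule perpetuity_cong, rule that) auto
      qed (use m in auto)
      also have "\<dots> \<le> (C * (u / 12 * (1 / 2) ^ i) powr (- \<theta>)) * (C * (2 ^ i) powr (- \<theta>))"
        using C upos m by (intro mult_mono tailW[OF iid] tailR[OF iid]) auto
      also have "\<dots> = C\<^sup>2 * ((u / 12 * (1 / 2) ^ i) * 2 ^ i) powr (- \<theta>)"
        using upos by (subst powr_mult) (auto simp: power2_eq_square)
      also have "(u / 12 * (1 / 2) ^ i) * 2 ^ i = u / 12" by (simp add: power_one_over)
      also have "(u / 12) powr (- \<theta>) = 12 powr \<theta> * ?U"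
        using upos by (simp add: powr_divide powr_minus field_simps)
      finally show ?thesis by (simp add: E_def)
    qed
    have "{\<omega>\<in>space M. chain_sum (?X \<omega>) n \<ge> u}
        \<subseteq> (\<Union>m\<in>{1..n}. A1 m) \<union> (\<Union>m\<in>{1..n}. A2 m) \<union> (\<Union>m\<in>{1..n}. A3 m) \<union> (\<Union>m\<in>{1..n}. \<Union>i\<in>{..<J}. A4 m i)"
    proof
      fix \<omega> assume "\<omega> \<in> {\<omega>\<in>space M. chain_sum (?X \<omega>) n \<ge> u}"
      then have w: "\<omega> \<in> space M" "chain_sum (?X \<omega>) n \<ge> u" by auto
      obtain m where m: "m \<in> {1..n}" and h: "affine_chain (?X \<omega>) m \<ge> u / 6
          \<or> passes (u / 3) m (?X \<omega>) \<and> chain_sum_after (?X \<omega>) m n \<ge> u / 3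
          \<or> passes (u / 3) m (?X \<omega>) \<and> perpetuity (?X \<omega>) m n \<ge> 2 ^ J
          \<or> (\<exists>i<J. affine_chain (?X \<omega>) m \<ge> u / 12 * (1 / 2) ^ i \<and> perpetuity (?X \<omega>) m n \<ge> 2 ^ i)"
        using chain_sum_large_cases[OF upos w(2), of J] by blast
      have "\<omega> \<in> A1 m \<union> A2 m \<union> A3 m \<union> (\<Union>i\<in>{..<J}. A4 m i)"
        using h w(1) unfolding A1_def A2_def A3_def A4_def by blast
      then show "\<omega> \<in> (\<Union>m\<in>{1..n}. A1 m) \<union> (\<Union>m\<in>{1..n}. A2 m) \<union> (\<Union>m\<in>{1..n}. A3 m) \<union> (\<Union>m\<in>{1..n}. \<Union>i\<in>{..<J}. A4 m i)"
        using m by blast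
    qed
    then have "\<P>(\<omega> in M. chain_sum (?X \<omega>) n \<ge> u)
        \<le> prob ((\<Union>m\<in>{1..n}. A1 m) \<union> (\<Union>m\<in>{1..n}. A2 m) \<union> (\<Union>m\<in>{1..n}. A3 m) \<union> (\<Union>m\<in>{1..n}. \<Union>i\<in>{..<J}. A4 m i))"
      by (intro finite_measure_mono) auto
    also have "\<dots> \<le> prob (\<Union>m\<in>{1..n}. A1 m) + prob (\<Union>m\<in>{1..n}. A2 m) + prob (\<Union>m\<in>{1..n}. A3 m) + prob (\<Union>m\<in>{1..n}. \<Union>i\<in>{..<J}. A4 m i)"
      by (intro order_trans[OF measure_Un_le] add_right_mono) auto
    also have "\<dots> \<le> (\<Sum>m\<in>{1..n}. prob (A1 m)) + (\<Sum>m\<in>{1..n}. prob (A2 m)) + (\<Sum>m\<in>{1..n}. prob (A3 m)) + (\<Sum>m\<in>{1..n}. \<Sum>i\<in>{..<J}. prob (A4 m i))"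
    proof (intro add_mono)
      have "prob (\<Union>m\<in>{1..n}. \<Union>i\<in>{..<J}. A4 m i) \<le> (\<Sum>m\<in>{1..n}. prob (\<Union>i\<in>{..<J}. A4 m i))"
        by (intro finite_measure_subadditive_finite) auto
      also have "\<dots> \<le> (\<Sum>m\<in>{1..n}. \<Sum>i\<in>{..<J}. prob (A4 m i))"
        by (intro sum_mono finite_measure_subadditive_finite) auto
      finally show "prob (\<Union>m\<in>{1..n}. \<Union>i\<in>{..<J}. A4 m i) \<le> (\<Sum>m\<in>{1..n}. \<Sum>i\<in>{..<J}. prob (A4 m i))" .
    qed (intro finite_measure_subadditive_finite; auto)+
    also have "\<dots> \<le> (\<Sum>m\<in>{1..n}. C * 6 powr \<theta> * ?U) + (\<Sum>m\<in>{1..n}. \<P>(\<omega> in M. passes (u / 3) m (?X \<omega>)) * p)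
        + (\<Sum>m\<in>{1..n}. \<P>(\<omega> in M. passes (u / 3) m (?X \<omega>)) * (C * real n powr (- \<theta>))) + (\<Sum>m\<in>{1..n}. \<Sum>i\<in>{..<J}. E * ?U)"
      by (intro add_mono sum_mono A1 A2 A3 A4)
    also have "\<dots> = real n * (C * 6 powr \<theta> * ?U) + (\<Sum>m\<in>{1..n}. \<P>(\<omega> in M. passes (u / 3) m (?X \<omega>))) * (p + C * real n powr (- \<theta>)) + real n * (real J * (E * ?U))"
      by (simp add: sum_distrib_right[symmetric] distrib_left)
    also have "\<dots> \<le> real n * (C * 6 powr \<theta> * ?U) + p * (p + C * real n powr (- \<theta>)) + real n * (2 / ln 2 * ln (real n) * (E * ?U))"
      using sum_passes p_nonneg C DE J npos by (intro add_mono mult_left_mono mult_right_mono) auto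
    also have "p * (p + C * real n powr (- \<theta>)) \<le> real n * ((C\<^sup>2 * 9 powr \<theta> + C\<^sup>2 * 3 powr \<theta>) * ?U)"
    proof -
      let ?b = "C * 3 powr \<theta> * real n powr (1 + \<theta>) * ?U"
      have "real n powr (1 + 2 * \<theta>) \<le> real n powr (3 * \<theta>)" using theta1 n by (intro powr_mono) auto
      also have "\<dots> = (real n ^ 3) powr \<theta>" 
      proof -
        have "real n powr (3 * \<theta>) = (real n powr 3) powr \<theta>" by (simp only: powr_powr)
        then show ?thesis using npos by simp
      qed
      also have "\<dots> \<le> u powr \<theta>" using u npos theta_pos by (intro powr_mono2) auto
      finally have key: "real n powr (1 + 2 * \<theta>) * ?U \<le> 1" using upos by (simp add: powr_minus field_simps)
      have "p * (p + C * real n powr (- \<theta>)) \<le> ?b * (?b + C * real n powr (- \<theta>))"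
        using p_le p_nonneg C by (intro mult_mono add_mono) auto
      also have "\<dots> = C\<^sup>2 * (3 powr \<theta> * 3 powr \<theta>) * (real n powr (1 + \<theta>) * real n powr (1 + \<theta>)) * ?U * ?U
          + C\<^sup>2 * 3 powr \<theta> * (real n powr (1 + \<theta>) * real n powr (- \<theta>)) * ?U"
        by (simp add: power2_eq_square algebra_simps)
      also have "real n powr (1 + \<theta>) * real n powr (1 + \<theta>) = real n * real n powr (1 + 2 * \<theta>)"
      proof -
        have "real n powr (1 + \<theta>) * real n powr (1 + \<theta>) = real n powr 1 * real n powr (1 + 2 * \<theta>)"
          unfolding powr_add[symmetric] by simp
        then show ?thesis using npos by simp
      qed
      also have "real n powr (1 + \<theta>) * real n powr (- \<theta>) = real n"
        unfolding powr_add[symmetric] using npos by simp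
      also have "3 powr \<theta> * 3 powr \<theta> = (9::real) powr \<theta>"
        by (simp add: powr_mult[symmetric])
      also have "C\<^sup>2 * 9 powr \<theta> * (real n * real n powr (1 + 2 * \<theta>)) * ?U * ?U
          = C\<^sup>2 * 9 powr \<theta> * real n * ?U * (real n powr (1 + 2 * \<theta>) * ?U)" by simp
      also have "\<dots> \<le> C\<^sup>2 * 9 powr \<theta> * real n * ?U * 1" using key by (intro mult_left_mono) auto
      finally show ?thesis by (simp add: algebra_simps)
    qed
    also have "real n * (C * 6 powr \<theta> * ?U) + real n * ((C\<^sup>2 * 9 powr \<theta> + C\<^sup>2 * 3 powr \<theta>) * ?U)
         + real n * (2 / ln 2 * ln (real n) * (E * ?U)) = real n * ?U * (D * 1 + E * (2 / ln 2 * ln (real n)))"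
      by (simp add: D_def algebra_simps)
    also have "\<dots> \<le> real n * ?U * (D * (ln (real n) / ln 2) + E * (2 / ln 2 * ln (real n)))"
      using DE n npos by (intro mult_left_mono add_mono) auto
    also have "\<dots> = (D / ln 2 + E * (2 / ln 2)) * (real n * ln (real n)) * ?U" by (simp add: algebra_simps)
    finally show ?thesis by simp
  qed
  show ?thesis using main DE by (intro exI[of _ "D / ln 2 + E * (2 / ln 2)"]) auto
qed

text \<open>For \<open>u \<ge> n\<^sup>3\<close> this is the previous bound. For smaller \<open>u\<close> the logarithms of \<open>u\<close> and \<open>n\<close> are comparable, and the
supermartingale is used with \<open>l = 3 \<theta> ln n / u\<close>: then \<open>exp (- l u) = n powr (- 3 \<theta>) \<le> u powr (- \<theta>)\<close>, the drift \<open>l K n\<close> is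
bounded because \<open>u\<close> is at least a multiple of \<open>n ln n\<close>, and the truncation at a level of order \<open>u / ln n\<close>
fails with probability of order \<open>n * (ln n / u) powr \<theta>\<close>.\<close>
lemma chain_sum_tail_light:
  assumes theta1: "\<theta> > 1" and v0: "v0 > 0"
  shows "\<exists>C\<ge>0. \<forall>n \<eta> u. iid n \<eta> \<and> n \<ge> 2 \<and> u \<ge> v0 * (real n * ln (real n)) \<longrightarrow>
     \<P>(\<omega> in M. chain_sum (\<lambda>i. \<eta> i \<omega>) n \<ge> u) \<le> C * real n * ln (real n) powr \<theta> * u powr (- \<theta>)"
proof -
  obtain F where F: "F \<ge> 0" and far: "\<And>n \<eta> u. iid n \<eta> \<Longrightarrow> n \<ge> 2 \<Longrightarrow> u \<ge> real n ^ 3 \<Longrightarrow>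
     \<P>(\<omega> in M. chain_sum (\<lambda>i. \<eta> i \<omega>) n \<ge> u) \<le> F * (real n * ln (real n)) * u powr (- \<theta>)"
    using chain_sum_tail_far[OF theta1] by blast
  obtain C where C: "C \<ge> 0" and tailW: "\<And>n \<eta> m u. iid n \<eta> \<Longrightarrow> m \<le> n \<Longrightarrow> u > 0 \<Longrightarrow>
      \<P>(\<omega> in M. affine_chain (\<lambda>i. \<eta> i \<omega>) m \<ge> u) \<le> C * u powr (- \<theta>)"
    using chain_and_perpetuity_tail by blast
  obtain c K where c: "c > 0" and K: "K \<ge> 0" and trunc: "\<And>n \<eta> l u. iid n \<eta> \<Longrightarrow> l > 0 \<Longrightarrow>
     \<P>(\<omega> in M. chain_sum (\<lambda>i. \<eta> i \<omega>) n \<ge> u \<and> (\<forall>j\<le>n. affine_chain (\<lambda>i. \<eta> i \<omega>) j \<le> c / l))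
       \<le> exp (l * K * real n - l * u)"
    using truncated_exponential_moment[OF theta1] by blast
  define G where "G = C * (3 * \<theta> / c) powr \<theta> + exp (3 * \<theta> * K / v0) * ln 2 powr (- \<theta>)"
  define F' where "F' = F * ln 2 powr (1 - \<theta>)"
  have nonneg: "G \<ge> 0" "F' \<ge> 0" using C F by (auto simp: G_def F'_def)
  have main: "\<P>(\<omega> in M. chain_sum (\<lambda>i. \<eta> i \<omega>) n \<ge> u) \<le> (F' + G) * real n * ln (real n) powr \<theta> * u powr (- \<theta>)"
    if iid: "iid n \<eta>" and n: "n \<ge> 2" and u: "u \<ge> v0 * (real n * ln (real n))" for n \<eta> u
  proof -
    note [measurable] = iid_measurable[OF iid]
    let ?X = "\<lambda>\<omega> i. \<eta> i \<omega>"
    have ln2: "0 < ln (2::real)" "ln 2 \<le> ln (real n)" using n by auto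
    then have lnpos: "0 < ln (real n)" by linarith
    have npos: "real n > 0" using n by simp
    have upos: "u > 0" using u v0 npos lnpos by (meson less_le_trans mult_pos_pos)
    define B where "B = real n * ln (real n) powr \<theta> * u powr (- \<theta>)"
    have B: "B \<ge> 0" by (simp add: B_def)
    show ?thesis
    proof (cases "u \<ge> real n ^ 3")
      case True
      have "ln (real n) = ln (real n) powr \<theta> * ln (real n) powr (1 - \<theta>)"
        unfolding powr_add[symmetric] using lnpos by simp
      also have "\<dots> \<le> ln (real n) powr \<theta> * ln 2 powr (1 - \<theta>)"
        using ln2 theta1 by (intro mult_left_mono powr_mono2') auto
      finally have "F * (real n * ln (real n)) * u powr (- \<theta>) \<le> F * (real n * (ln (real n) powr \<theta> * ln 2 powr (1 - \<theta>))) * u powr (- \<theta>)"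
        using F by (intro mult_right_mono mult_left_mono) auto
      also have "\<dots> = F' * B" by (simp add: B_def F'_def)
      also have "\<dots> \<le> (F' + G) * B" using nonneg B by (simp add: distrib_right)
      finally show ?thesis using far[OF iid n True] by (simp add: B_def mult.assoc)
    next
      case False
      define l where "l = 3 * \<theta> * ln (real n) / u"
      have l: "l > 0" using theta1 lnpos upos by (simp add: l_def)
      have "{\<omega>\<in>space M. chain_sum (?X \<omega>) n \<ge> u} \<subseteq> (\<Union>j\<in>{..n}. {\<omega>\<in>space M. affine_chain (?X \<omega>) j \<ge> c / l})
          \<union> {\<omega>\<in>space M. chain_sum (?X \<omega>) n \<ge> u \<and> (\<forall>j\<le>n. affine_chain (?X \<omega>) j \<le> c / l)}"
        by (auto simp: not_le intro: less_imp_le)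
      then have "\<P>(\<omega> in M. chain_sum (?X \<omega>) n \<ge> u) \<le> prob ((\<Union>j\<in>{..n}. {\<omega>\<in>space M. affine_chain (?X \<omega>) j \<ge> c / l})
          \<union> {\<omega>\<in>space M. chain_sum (?X \<omega>) n \<ge> u \<and> (\<forall>j\<le>n. affine_chain (?X \<omega>) j \<le> c / l)})"
        by (intro finite_measure_mono) auto
      also have "\<dots> \<le> prob (\<Union>j\<in>{..n}. {\<omega>\<in>space M. affine_chain (?X \<omega>) j \<ge> c / l})
          + \<P>(\<omega> in M. chain_sum (?X \<omega>) n \<ge> u \<and> (\<forall>j\<le>n. affine_chain (?X \<omega>) j \<le> c / l))"
        by (intro measure_Un_le) auto
      also have "(\<Union>j\<in>{..n}. {\<omega>\<in>space M. affine_chain (?X \<omega>) j \<ge> c / l}) = (\<Union>j\<in>{1..n}. {\<omega>\<in>space M. affine_chain (?X \<omega>) j \<ge> c / l})"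
      proof -
        have "{..n} = insert 0 {1..n}" by auto
        moreover have "{\<omega>\<in>space M. affine_chain (?X \<omega>) 0 \<ge> c / l} = {}" using c l by (simp add: not_le)
        ultimately show ?thesis by (simp only: UN_insert Un_empty_left)
      qed
      also have "prob \<dots> \<le> (\<Sum>j\<in>{1..n}. \<P>(\<omega> in M. affine_chain (?X \<omega>) j \<ge> c / l))"
        by (intro finite_measure_subadditive_finite) auto
      also have "\<dots> \<le> (\<Sum>j\<in>{1..n}. C * (c / l) powr (- \<theta>))"
        using c l by (intro sum_mono tailW[OF iid]) auto
      also have "\<dots> = C * (3 * \<theta> / c) powr \<theta> * B"
      proof -
        have "(c / l) powr (- \<theta>) = (l / c) powr \<theta>"
          using c l by (simp add: powr_minus powr_divide)
        also have "l / c = 3 * \<theta> / c * (ln (real n) * inverse u)" using upos by (simp add: l_def field_simps)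
        also have "\<dots> powr \<theta> = (3 * \<theta> / c) powr \<theta> * (ln (real n) powr \<theta> * u powr (- \<theta>))"
          using c theta1 lnpos upos by (subst powr_mult; simp)+ (simp add: inverse_powr powr_minus)
        finally show ?thesis by (simp add: B_def)
      qed
      also have "\<P>(\<omega> in M. chain_sum (?X \<omega>) n \<ge> u \<and> (\<forall>j\<le>n. affine_chain (?X \<omega>) j \<le> c / l)) \<le> exp (l * K * real n - l * u)"
        by (rule trunc[OF iid l])
      also have "exp (l * K * real n - l * u) \<le> exp (3 * \<theta> * K / v0) * ln 2 powr (- \<theta>) * B"
      proof -
        have "v0 * (l * K * real n) = 3 * \<theta> * K * (v0 * (real n * ln (real n))) / u"
          by (simp add: l_def)
        also have "\<dots> \<le> 3 * \<theta> * K * u / u"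
          using u upos K theta1 by (intro divide_right_mono mult_left_mono) auto
        finally have 1: "l * K * real n \<le> 3 * \<theta> * K / v0"
          using v0 upos by (simp add: field_simps)
        have "exp (l * K * real n - l * u) = exp (l * K * real n) * exp (- (3 * \<theta> * ln (real n)))"
          using upos by (simp add: l_def exp_diff exp_minus divide_inverse)
        also have "\<dots> \<le> exp (3 * \<theta> * K / v0) * exp (- (3 * \<theta> * ln (real n)))"
          using 1 by (intro mult_right_mono) auto
        also have "exp (- (3 * \<theta> * ln (real n))) = (real n ^ 3) powr (- \<theta>)"
          using npos by (simp add: powr_def ln_realpow)
        also have "\<dots> \<le> u powr (- \<theta>)"
          using False upos theta1 by (intro powr_mono2') auto
        also have "\<dots> \<le> ln 2 powr (- \<theta>) * B"
        proof -
          have "1 * 1 \<le> real n * (ln (real n) / ln 2) powr \<theta>"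
            using n ln2 theta1 by (intro mult_mono ge_one_powr_ge_zero) auto
          then have "1 * u powr (- \<theta>) \<le> real n * (ln (real n) / ln 2) powr \<theta> * u powr (- \<theta>)"
            by (intro mult_right_mono) auto
          also have "\<dots> = ln 2 powr (- \<theta>) * B"
            using lnpos ln2 by (simp add: B_def powr_divide powr_minus field_simps)
          finally show ?thesis by simp
        qed
        finally show ?thesis by (simp add: mult.assoc mult_left_mono)
      qed
      also have "C * (3 * \<theta> / c) powr \<theta> * B + exp (3 * \<theta> * K / v0) * ln 2 powr (- \<theta>) * B = G * B"
        by (simp add: G_def distrib_right)
      also have "\<dots> \<le> (F' + G) * B" using nonneg B by (simp add: distrib_right)
      finally show ?thesis by (simp add: B_def mult.assoc)
    qed
  qed
  show ?thesis using main nonneg by (intro exI[of _ "F' + G"]) auto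
qed
end

section \<open>Tail bounds for the sum of exponentials\<close>

lemma exp_pair_sum_eq_chain_sum:
  "exp_pair_sum \<xi> N \<omega> = chain_sum (\<lambda>i. \<xi> i \<omega>) N"
proof -
  have "partial_sum \<xi> m \<omega> - partial_sum \<xi> k \<omega> = walk (\<lambda>i. \<xi> i \<omega>) k m" if "k \<le> m" for k m
  proof -
    have "partial_sum \<xi> l \<omega> = walk (\<lambda>i. \<xi> i \<omega>) 0 l" for l
      unfolding partial_sum_def walk_def by (intro sum.cong) auto
    then show ?thesis using walk_append[of 0 k m "\<lambda>i. \<xi> i \<omega>"] that by simp
  qed
  then have "chain_sum (\<lambda>i. \<xi> i \<omega>) N
      = (\<Sum>m\<in>{1..N}. \<Sum>k\<in>{1..m}. exp (partial_sum \<xi> m \<omega> - partial_sum \<xi> k \<omega>))"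
    unfolding chain_sum_def affine_chain_def by (intro sum.cong) auto
  also have "\<dots> = (\<Sum>(m, k)\<in>(SIGMA m:{1..N}. {1..m}). exp (partial_sum \<xi> m \<omega> - partial_sum \<xi> k \<omega>))"
    by (rule sum.Sigma) auto
  also have "\<dots> = exp_pair_sum \<xi> N \<omega>"
    unfolding exp_pair_sum_def
    by (rule sum.reindex_bij_witness[of _ "\<lambda>(k, m). (m, k)" "\<lambda>(m, k). (k, m)"]) auto
  finally show ?thesis by simp
qed

theorem theoremA2:
  fixes M :: "'a measure" and \<xi> :: "nat \<Rightarrow> 'a \<Rightarrow> real"
    and \<nu> :: "real measure" and B \<theta> :: real
  assumes "prob_space M"
    and indep: "prob_space.indep_vars M (\<lambda>_. borel) \<xi> {1..}"
    and law: "\<And>i. i \<ge> 1 \<Longrightarrow> distr M borel (\<xi> i) = \<nu>"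
    and C1: "B > 0" "\<And>t. t \<in> {0..B} \<Longrightarrow> integrable \<nu> (\<lambda>x. exp (t * x))"
    and C2: "integrable \<nu> (\<lambda>x. x)" "(\<integral>x. x \<partial>\<nu>) < 0"
    and C3: "non_lattice \<nu>"
    and theta: "\<theta> > 0" "integrable \<nu> (\<lambda>x. exp (\<theta> * x))" "(\<integral>x. exp (\<theta> * x) \<partial>\<nu>) = 1"
  shows
    "(\<theta> < 1 \<longrightarrow>
        (\<forall>u\<^sub>0>1. \<exists>C. \<forall>N::nat. \<forall>u. N \<ge> 1 \<and> u \<ge> u\<^sub>0 \<longrightarrow>
           measure M {\<omega> \<in> space M. exp_pair_sum \<xi> N \<omega> \<ge> u}
             \<le> C * real N * (ln u powr \<theta> / u powr \<theta>))
      \<and> (\<exists>C. \<forall>N::nat. \<forall>v. N \<ge> 2 \<and> v > 0 \<longrightarrow>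
           measure M {\<omega> \<in> space M.
               exp_pair_sum \<xi> N \<omega> / (real N powr (1 / \<theta>) * ln (real N)) \<ge> v}
             \<le> C / v powr \<theta>)
      \<and> bounded_in_prob M (\<lambda>n \<omega>.
           exp_pair_sum \<xi> (n + 2) \<omega> / (real (n + 2) powr (1 / \<theta>) * ln (real (n + 2)))))
   \<and> (\<theta> > 1 \<longrightarrow>
        (\<exists>C\<^sub>0>0. \<exists>C. \<forall>N::nat. \<forall>u. N \<ge> 1 \<and> u > 1 \<and> u > C\<^sub>0 * real N * ln (real N) \<longrightarrow>
           measure M {\<omega> \<in> space M. exp_pair_sum \<xi> N \<omega> \<ge> u}
             \<le> C * real N * ln u powr \<theta> / u powr \<theta>)
      \<and> (\<forall>v\<^sub>0>0. \<exists>C. \<forall>N::nat. \<forall>v. N \<ge> 2 \<and> v \<ge> v\<^sub>0 \<longrightarrow>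
           measure M {\<omega> \<in> space M. exp_pair_sum \<xi> N \<omega> / (real N * ln (real N)) \<ge> v}
             \<le> C / (real N powr (\<theta> - 1) * v powr \<theta>))
      \<and> tendsto_in_prob M (\<lambda>N \<omega>. exp_pair_sum \<xi> N \<omega> / (real N * ln (real N))) 0)"
proof -
  interpret prob_space M by fact
  have rv: "\<xi> i \<in> borel_measurable M" if "i \<ge> 1" for i
    using indep that by (auto simp: indep_vars_def2)
  have nu: "prob_space \<nu>" using prob_space_distr[OF rv[of 1]] law[of 1] by simp
  have sets_nu: "sets \<nu> = sets borel" using law[of 1] by auto
  interpret cramer_walk M \<nu> \<theta>
    by (intro cramer_walk.intro cramer_walk_axioms.intro prob_space_axioms nu sets_nu theta C2)
  \<comment> \<open>Agrees with \<open>\<xi>\<close> on the indices from 1 on and has only measurable coordinates.\<close>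
  define \<eta> where "\<eta> i = (if i = 0 then \<xi> 1 else \<xi> i)" for i
  have iid: "iid n \<eta>" for n
    unfolding iid_def
  proof (intro conjI allI ballI)
    show "\<eta> i \<in> borel_measurable M" for i using rv by (simp add: \<eta>_def)
    have "indep_vars (\<lambda>_. borel) \<xi> {1..n}" using indep by (rule indep_vars_subset) auto
    then show "indep_vars (\<lambda>_. borel) \<eta> {1..n}"
      by (subst indep_vars_cong[where Y = \<xi> and J = "{1..n}" and N' = "\<lambda>_. borel"]) (auto simp: \<eta>_def)
    show "distr M borel (\<eta> i) = \<nu>" if "i \<in> {1..n}" for i using that law by (simp add: \<eta>_def)
  qed
  define T where "T = exp_pair_sum \<xi>"
  have T_eq: "T n \<omega> = chain_sum (\<lambda>i. \<eta> i \<omega>) n" for n \<omega>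
    unfolding T_def exp_pair_sum_eq_chain_sum by (rule chain_sum_cong) (simp add: \<eta>_def)
  have T_meas [measurable]: "T n \<in> borel_measurable M" for n
    unfolding T_eq[abs_def] using iid_measurable[OF iid[of 0]] by measurable
  have T_nonneg: "0 \<le> T n \<omega>" for n \<omega>
    unfolding T_eq chain_sum_def by (intro sum_nonneg chain_nonneg)
  have T_1: "T 1 \<omega> = 1" for \<omega> by (simp add: T_eq chain_sum_def affine_chain_def)
  have scale: "{\<omega>\<in>space M. T n \<omega> / s \<ge> v} = {\<omega>\<in>space M. T n \<omega> \<ge> v * s}" if "s > 0" for n s v
    using that by (simp add: pos_le_divide_eq)

  have heavy: "(\<forall>u\<^sub>0>1. \<exists>C. \<forall>N::nat. \<forall>u. N \<ge> 1 \<and> u \<ge> u\<^sub>0 \<longrightarrow>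
           measure M {\<omega> \<in> space M. T N \<omega> \<ge> u} \<le> C * real N * (ln u powr \<theta> / u powr \<theta>))
      \<and> (\<exists>C. \<forall>N::nat. \<forall>v. N \<ge> 2 \<and> v > 0 \<longrightarrow>
           measure M {\<omega> \<in> space M. T N \<omega> / (real N powr (1 / \<theta>) * ln (real N)) \<ge> v} \<le> C / v powr \<theta>)
      \<and> bounded_in_prob M (\<lambda>n \<omega>. T (n + 2) \<omega> / (real (n + 2) powr (1 / \<theta>) * ln (real (n + 2))))"
    if theta1: "\<theta> < 1"
  proof -
    obtain C where C: "C \<ge> 0" and tail: "\<And>n u. u > 0 \<Longrightarrow> \<P>(\<omega> in M. T n \<omega> \<ge> u) \<le> C * real n * u powr (- \<theta>)"
      using chain_sum_tail_heavy[OF theta1] iid unfolding T_eq by blast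
    have part1: "\<exists>C. \<forall>N::nat. \<forall>u. N \<ge> 1 \<and> u \<ge> u0 \<longrightarrow>
           measure M {\<omega> \<in> space M. T N \<omega> \<ge> u} \<le> C * real N * (ln u powr \<theta> / u powr \<theta>)"
      if u0: "u0 > 1" for u0
    proof (intro exI[of _ "C / ln u0 powr \<theta>"] allI impI)
      fix N :: nat and u :: real assume h: "N \<ge> 1 \<and> u \<ge> u0"
      have l0: "ln u0 > 0" using u0 by simp
      have "ln u0 powr \<theta> \<le> ln u powr \<theta>" using h u0 theta_pos by (intro powr_mono2) auto
      then have "1 \<le> ln u powr \<theta> / ln u0 powr \<theta>" using l0 by simp
      then have "C * real N * u powr (- \<theta>) * 1 \<le> C * real N * u powr (- \<theta>) * (ln u powr \<theta> / ln u0 powr \<theta>)"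
        using C by (intro mult_left_mono) auto
      also have "\<dots> = C / ln u0 powr \<theta> * real N * (ln u powr \<theta> / u powr \<theta>)"
        by (simp add: powr_minus divide_inverse)
      finally show "measure M {\<omega> \<in> space M. T N \<omega> \<ge> u} \<le> C / ln u0 powr \<theta> * real N * (ln u powr \<theta> / u powr \<theta>)"
        using tail[of u N] h u0 by simp
    qed
    define D where "D = C * ln 2 powr (- \<theta>)"
    have D: "D \<ge> 0" using C by (simp add: D_def)
    \<comment> \<open>Since the tail bound is free of logarithms, the normalisation by \<open>ln N\<close> leaves the bounded factor \<open>ln N powr (- \<theta>)\<close>.\<close>
    have part2: "measure M {\<omega> \<in> space M. T N \<omega> / (real N powr (1 / \<theta>) * ln (real N)) \<ge> v} \<le> D / v powr \<theta>"
      if N: "N \<ge> 2" and v: "v > 0" for N :: nat and v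
    proof -
      define s where "s = real N powr (1 / \<theta>) * ln (real N)"
      have lnN: "0 < ln (real N)" "ln 2 \<le> ln (real N)" using N by auto
      have s: "s > 0" using N lnN by (simp add: s_def)
      have "measure M {\<omega> \<in> space M. T N \<omega> / s \<ge> v} \<le> C * real N * (v * s) powr (- \<theta>)"
        unfolding scale[OF s] using s v by (intro tail) auto
      also have "(v * s) powr (- \<theta>) = v powr (- \<theta>) * ((real N powr (1 / \<theta>)) powr (- \<theta>) * ln (real N) powr (- \<theta>))"
        using v lnN N by (simp add: s_def powr_mult)
      also have "(real N powr (1 / \<theta>)) powr (- \<theta>) = inverse (real N)"
        using theta_pos N by (simp add: powr_powr powr_minus)
      also have "C * real N * (v powr (- \<theta>) * (inverse (real N) * ln (real N) powr (- \<theta>))) = C * v powr (- \<theta>) * ln (real N) powr (- \<theta>)"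
        using N by simp
      also have "\<dots> \<le> C * v powr (- \<theta>) * ln 2 powr (- \<theta>)"
        using C lnN theta_pos by (intro mult_left_mono powr_mono2') auto
      also have "\<dots> = D / v powr \<theta>" by (simp add: D_def powr_minus divide_inverse)
      finally show ?thesis unfolding s_def .
    qed
    have part3: "bounded_in_prob M (\<lambda>n \<omega>. T (n + 2) \<omega> / (real (n + 2) powr (1 / \<theta>) * ln (real (n + 2))))"
      unfolding bounded_in_prob_def tight_def
    proof (intro conjI allI impI)
      fix n
      show "real_distribution (distr M borel (\<lambda>\<omega>. T (n + 2) \<omega> / (real (n + 2) powr (1 / \<theta>) * ln (real (n + 2)))))"
        by (rule real_distribution_distr) measurable
    next
      fix \<epsilon> :: real assume eps: "\<epsilon> > 0"
      define b where "b = (2 * (D + 1) / \<epsilon>) powr (1 / \<theta>)"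
      have b: "b > 0" using D eps by (simp add: b_def)
      have "b powr \<theta> = 2 * (D + 1) / \<epsilon>" using theta_pos D eps by (simp add: b_def powr_powr)
      then have "D < \<epsilon> * b powr \<theta>" using D eps by simp
      then have small: "D / b powr \<theta> < \<epsilon>" using b by (simp add: pos_divide_less_eq)
      have "measure (distr M borel (\<lambda>\<omega>. T (n + 2) \<omega> / (real (n + 2) powr (1 / \<theta>) * ln (real (n + 2))))) {-1<..b} > 1 - \<epsilon>" for n
      proof -
        define X where "X \<omega> = T (n + 2) \<omega> / (real (n + 2) powr (1 / \<theta>) * ln (real (n + 2)))" for \<omega>
        have [measurable]: "X \<in> borel_measurable M" unfolding X_def[abs_def] by measurable
        have X0: "0 \<le> X \<omega>" for \<omega> unfolding X_def using T_nonneg by (intro divide_nonneg_nonneg mult_nonneg_nonneg) auto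
        have "1 - \<P>(\<omega> in M. X \<omega> \<ge> b) = prob (space M - {\<omega>\<in>space M. X \<omega> \<ge> b})"
          by (subst prob_compl) auto
        also have "\<dots> \<le> prob (X -` {-1<..b} \<inter> space M)"
        proof (intro finite_measure_mono)
          have "X \<omega> \<in> {-1<..b}" if "\<not> X \<omega> \<ge> b" for \<omega> using X0[of \<omega>] that by simp
          then show "space M - {\<omega>\<in>space M. X \<omega> \<ge> b} \<subseteq> X -` {-1<..b} \<inter> space M" by blast
        qed measurable
        also have "\<dots> = measure (distr M borel X) {-1<..b}" by (subst measure_distr) auto
        finally have "1 - \<P>(\<omega> in M. X \<omega> \<ge> b) \<le> measure (distr M borel X) {-1<..b}" .
        moreover have "\<P>(\<omega> in M. X \<omega> \<ge> b) < \<epsilon>"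
          using part2[of "n + 2" b] b small unfolding X_def by linarith
        ultimately show ?thesis unfolding X_def[abs_def] by linarith
      qed
      then show "\<exists>a b. a < b \<and> (\<forall>n. measure (distr M borel (\<lambda>\<omega>. T (n + 2) \<omega> / (real (n + 2) powr (1 / \<theta>) * ln (real (n + 2))))) {a<..b} > 1 - \<epsilon>)"
        using b by (intro exI[of _ "-1"] exI[of _ b]) auto
    qed
    show ?thesis using part1 part2 part3 by blast
  qed

  have light: "(\<exists>C\<^sub>0>0. \<exists>C. \<forall>N::nat. \<forall>u. N \<ge> 1 \<and> u > 1 \<and> u > C\<^sub>0 * real N * ln (real N) \<longrightarrow>
           measure M {\<omega> \<in> space M. T N \<omega> \<ge> u} \<le> C * real N * ln u powr \<theta> / u powr \<theta>)
      \<and> (\<forall>v\<^sub>0>0. \<exists>C. \<forall>N::nat. \<forall>v. N \<ge> 2 \<and> v \<ge> v\<^sub>0 \<longrightarrow>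
           measure M {\<omega> \<in> space M. T N \<omega> / (real N * ln (real N)) \<ge> v} \<le> C / (real N powr (\<theta> - 1) * v powr \<theta>))
      \<and> tendsto_in_prob M (\<lambda>N \<omega>. T N \<omega> / (real N * ln (real N))) 0"
    if theta1: "\<theta> > 1"
  proof -
    have tail: "\<exists>C\<ge>0. \<forall>n u. n \<ge> 2 \<and> u \<ge> v0 * (real n * ln (real n)) \<longrightarrow>
        \<P>(\<omega> in M. T n \<omega> \<ge> u) \<le> C * real n * ln (real n) powr \<theta> * u powr (- \<theta>)" if "v0 > 0" for v0
      using chain_sum_tail_light[OF theta1 that] iid unfolding T_eq by blast
    have part1: "\<exists>C\<^sub>0>0. \<exists>C. \<forall>N::nat. \<forall>u. N \<ge> 1 \<and> u > 1 \<and> u > C\<^sub>0 * real N * ln (real N) \<longrightarrow>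
           measure M {\<omega> \<in> space M. T N \<omega> \<ge> u} \<le> C * real N * ln u powr \<theta> / u powr \<theta>"
    proof -
      \<comment> \<open>With this constant, \<open>u > C\<^sub>0 N ln N\<close> forces \<open>u \<ge> N\<close> for \<open>N \<ge> 2\<close>, hence \<open>ln N \<le> ln u\<close>.\<close>
      have pos: "1 / ln 2 > (0::real)" by simp
      obtain C where C: "C \<ge> 0" and bound: "\<And>n u. n \<ge> 2 \<Longrightarrow> u \<ge> 1 / ln 2 * (real n * ln (real n)) \<Longrightarrow>
          \<P>(\<omega> in M. T n \<omega> \<ge> u) \<le> C * real n * ln (real n) powr \<theta> * u powr (- \<theta>)"
        using tail[OF pos] by blast
      have "measure M {\<omega> \<in> space M. T N \<omega> \<ge> u} \<le> C * real N * ln u powr \<theta> / u powr \<theta>"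
        if h: "N \<ge> 1" "u > 1" "u > 1 / ln 2 * real N * ln (real N)" for N :: nat and u
      proof (cases "N = 1")
        case True
        then have none: "{\<omega> \<in> space M. T N \<omega> \<ge> u} = {}" using h T_1 by auto
        show ?thesis unfolding none using C by simp
      next
        case False
        then have N: "N \<ge> 2" using h by simp
        have lnN: "0 < ln (real N)" "1 \<le> ln (real N) / ln 2" using N by auto
        have "real N * 1 \<le> real N * (ln (real N) / ln 2)" using lnN by (intro mult_left_mono) auto
        then have "real N \<le> u" using h(3) by simp
        then have "ln (real N) powr \<theta> \<le> ln u powr \<theta>"
          using N lnN theta_pos by (intro powr_mono2) auto
        then have "C * real N * ln (real N) powr \<theta> * u powr (- \<theta>) \<le> C * real N * ln u powr \<theta> * u powr (- \<theta>)"
          using C by (intro mult_right_mono mult_left_mono) auto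
        then show ?thesis using bound[OF N, of u] h(3) by (simp add: powr_minus divide_inverse mult.assoc)
      qed
      then show ?thesis using pos by blast
    qed
    have part2: "\<exists>C. \<forall>N::nat. \<forall>v. N \<ge> 2 \<and> v \<ge> v0 \<longrightarrow>
           measure M {\<omega> \<in> space M. T N \<omega> / (real N * ln (real N)) \<ge> v} \<le> C / (real N powr (\<theta> - 1) * v powr \<theta>)"
      if v0: "v0 > 0" for v0
    proof -
      obtain C where C: "C \<ge> 0" and bound: "\<And>n u. n \<ge> 2 \<Longrightarrow> u \<ge> v0 * (real n * ln (real n)) \<Longrightarrow>
          \<P>(\<omega> in M. T n \<omega> \<ge> u) \<le> C * real n * ln (real n) powr \<theta> * u powr (- \<theta>)"
        using tail[OF v0] by blast
      have "measure M {\<omega> \<in> space M. T N \<omega> / (real N * ln (real N)) \<ge> v} \<le> C / (real N powr (\<theta> - 1) * v powr \<theta>)"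
        if N: "N \<ge> 2" and v: "v \<ge> v0" for N :: nat and v
      proof -
        define s where "s = real N * ln (real N)"
        have lnN: "0 < ln (real N)" using N by simp
        then have s: "s > 0" using N by (simp add: s_def)
        have vpos: "v > 0" using v v0 by simp
        have "measure M {\<omega> \<in> space M. T N \<omega> / s \<ge> v} \<le> C * real N * ln (real N) powr \<theta> * (v * s) powr (- \<theta>)"
          unfolding scale[OF s] using s v by (intro bound N) (auto simp: s_def[symmetric] intro: mult_right_mono)
        also have "\<dots> = C / (real N powr (\<theta> - 1) * v powr \<theta>)"
          using N lnN vpos by (simp add: s_def powr_mult powr_minus powr_diff field_simps)
        finally show ?thesis unfolding s_def .
      qed
      then show ?thesis by blast
    qed
    have part3: "tendsto_in_prob M (\<lambda>N \<omega>. T N \<omega> / (real N * ln (real N))) 0"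
      unfolding tendsto_in_prob_def
    proof (intro allI impI)
      fix \<epsilon> :: real assume eps: "\<epsilon> > 0"
      obtain C where C: "\<And>N::nat. N \<ge> 2 \<Longrightarrow>
          measure M {\<omega> \<in> space M. T N \<omega> / (real N * ln (real N)) \<ge> \<epsilon>} \<le> C / (real N powr (\<theta> - 1) * \<epsilon> powr \<theta>)"
        using part2[OF eps] by blast
      show "(\<lambda>N. measure M {\<omega> \<in> space M. \<bar>T N \<omega> / (real N * ln (real N)) - 0\<bar> \<ge> \<epsilon>}) \<longlonglongrightarrow> 0"
      proof (rule tendsto_sandwich[OF _ _ tendsto_const])
        show "\<forall>\<^sub>F N in sequentially. measure M {\<omega> \<in> space M. \<bar>T N \<omega> / (real N * ln (real N)) - 0\<bar> \<ge> \<epsilon>}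
            \<le> C / (real N powr (\<theta> - 1) * \<epsilon> powr \<theta>)"
          using eventually_ge_at_top[of 2]
        proof eventually_elim
          case (elim N)
          have "0 \<le> T N \<omega> / (real N * ln (real N))" for \<omega>
            using T_nonneg elim by (intro divide_nonneg_nonneg mult_nonneg_nonneg) auto
          then have abs: "\<bar>T N \<omega> / (real N * ln (real N)) - 0\<bar> = T N \<omega> / (real N * ln (real N))" for \<omega>
            by (simp only: diff_0_right abs_of_nonneg)
          show ?case unfolding abs by (rule C[OF elim])
        qed
        have "(\<lambda>N. C / \<epsilon> powr \<theta> * real N powr (1 - \<theta>)) \<longlonglongrightarrow> C / \<epsilon> powr \<theta> * 0"
          using theta1 by (intro tendsto_mult tendsto_const tendsto_neg_powr filterlim_real_sequentially) auto
        moreover have "C / (real N powr (\<theta> - 1) * \<epsilon> powr \<theta>) = C / \<epsilon> powr \<theta> * real N powr (1 - \<theta>)" for N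
          using powr_minus[of "real N" "\<theta> - 1"] by (simp add: divide_inverse)
        ultimately show "(\<lambda>N. C / (real N powr (\<theta> - 1) * \<epsilon> powr \<theta>)) \<longlonglongrightarrow> 0" by simp
      qed auto
    qed
    show ?thesis using part1 part2 part3 by blast
  qed
  show ?thesis using heavy light unfolding T_def by blast
qed
end
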